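(* Let $\mathbb{F}$ be a field, $k$ an integer, and for every $1 \leq i \leq k$ let $L_i \in \mathbb{F}^{n^{\alpha_i}\times n}$ and $R_i \in \mathbb{F}^{n\times n^{\beta_i}}$ be matrices with $\mathrm{rank}(L_i) = n^{\alpha_i}$ and $\mathrm{rank}(R_i) = n^{\beta_i}$, where $0 \leq \alpha_i, \beta_i \leq 1$. Assume that for all $A, B \in \mathbb{F}^{n\times n}$, $AB = 0$ if and only if $L_i A B R_i = 0$ for all $1 \leq i \leq k$. Then $$\sum_{i=1}^k n^{\alpha_i+\beta_i} \geq n^2, \quad\text{and}\quad \sum_{i=1}^k n^{\omega(1,1,\min(\alpha_i,\beta_i))} \geq \sum_{i=1}^k n^{\omega(\alpha_i,1,\beta_i)} \geq n^{\omega}.$$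
   Context: For $\alpha,\beta,\gamma\in[0,1]$, $\omega(\alpha,\beta,\gamma)$ is the infimum over $\omega'>0$ such that the product of an $n^\alpha\times n^\beta$ matrix and an $n^\beta\times n^\gamma$ matrix can be computed using $O(n^{\omega'})$ arithmetic operations; $\omega := \omega(1,1,1)$. *)

theory Defs
  imports
    "HOL-Library.Poly_Mapping"
    "HOL-Library.Nat_Bijection"
    "HOL-Library.Landau_Symbols"
    "HOL-Computational_Algebra.Fraction_Field"
    "Jordan_Normal_Form.Matrix"
    "Jordan_Normal_Form.DL_Rank"
begin

text \<open>
  Arithmetic operations are counted in the standard model of algebraic complexity theory:
  straight-line computations over the field \<open>F(x\<^sub>0, x\<^sub>1, \<dots>)\<close> of rational functions, whose inputs
  are indeterminates.  Scalars from \<open>F\<close> are available for free; each addition, subtraction,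
  multiplication and division costs one.  Working with indeterminates rather than with functions
  on \<open>F\<close> matters for finite \<open>F\<close>, where distinct polynomials may agree as functions.
\<close>

inductive straight_line :: "'k::field set \<Rightarrow> 'k list \<Rightarrow> bool"
  for S :: "'k set"
where
  empty: "straight_line S []"
| step: "\<lbrakk>straight_line S gs; u \<in> S \<union> set gs; v \<in> S \<union> set gs;
          g = u + v \<or> g = u - v \<or> g = u * v \<or> (v \<noteq> 0 \<and> g = u / v)\<rbrakk>
         \<Longrightarrow> straight_line S (gs @ [g])"

definition computable_in :: "'k::field set \<Rightarrow> 'k set \<Rightarrow> nat \<Rightarrow> bool" where
  "computable_in S Y s \<longleftrightarrow>
     (\<exists>gs. straight_line S gs \<and> length gs \<le> s \<and> Y \<subseteq> S \<union> set gs)"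

type_synonym 'f ratfun = "((nat \<Rightarrow>\<^sub>0 nat) \<Rightarrow>\<^sub>0 'f) fract"

definition rf_const :: "'f::field \<Rightarrow> 'f ratfun" where
  "rf_const c = Fract (Poly_Mapping.single 0 c) 1"

definition rf_var :: "nat \<Rightarrow> 'f::field ratfun" where
  "rf_var v = Fract (Poly_Mapping.single (Poly_Mapping.single v 1) 1) 1"

text \<open>Two generic matrices whose entries are pairwise distinct indeterminates: those of the left
  factor have even index, those of the right factor odd index.\<close>

definition generic_left :: "nat \<Rightarrow> nat \<Rightarrow> 'f::field ratfun mat" where
  "generic_left p q = mat p q (\<lambda>ij. rf_var (2 * prod_encode ij))"

definition generic_right :: "nat \<Rightarrow> nat \<Rightarrow> 'f::field ratfun mat" where
  "generic_right q r = mat q r (\<lambda>jk. rf_var (2 * prod_encode jk + 1))"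

definition matmul_in :: "'f::field itself \<Rightarrow> nat \<Rightarrow> nat \<Rightarrow> nat \<Rightarrow> nat \<Rightarrow> bool" where
  "matmul_in _ p q r s \<longleftrightarrow>
     computable_in
       (range (rf_const :: 'f \<Rightarrow> 'f ratfun)
          \<union> elements_mat (generic_left p q) \<union> elements_mat (generic_right q r))
       (elements_mat (generic_left p q * generic_right q r)) s"

text \<open>Dimensions \<open>n\<^sup>a\<close> are rounded down to integers.\<close>

definition dim_pow :: "nat \<Rightarrow> real \<Rightarrow> nat" where
  "dim_pow n a = nat \<lfloor>real n powr a\<rfloor>"

definition omega_rect :: "'f::field itself \<Rightarrow> real \<Rightarrow> real \<Rightarrow> real \<Rightarrow> real" where
  "omega_rect F a b c = Inf {w. w > 0 \<and>
     (\<exists>s :: nat \<Rightarrow> nat. (\<lambda>n. real (s n)) \<in> O(\<lambda>n. real n powr w) \<and>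
        (\<forall>n. matmul_in F (dim_pow n a) (dim_pow n b) (dim_pow n c) (s n)))}"

definition omega :: "'f::field itself \<Rightarrow> real" where
  "omega F = omega_rect F 1 1 1"

end

theory Submission
  imports
    Defs
    "HOL-Library.Function_Algebras"
    "HOL-Real_Asymp.Real_Asymp"
begin

text \<open>
  Taking \<open>B = 1\<close>, the hypothesis says that \<open>M \<mapsto> (L\<^sub>i M R\<^sub>i)\<^sub>i\<close> is injective, which
  gives the first inequality by counting dimensions, and a linear left inverse. With the left inverse,
  a multiplication of format \<open>(n P, Q, n T)\<close> reduces to multiplications of formats
  \<open>(p\<^sub>i P, Q, s\<^sub>i T)\<close>, where \<open>p\<^sub>i = n\<close> to the \<open>\<alpha>\<^sub>i\<close> and \<open>s\<^sub>i = n\<close> to the \<open>\<beta>\<^sub>i\<close>. Iterating this \<open>m\<close> times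
  and collecting equal factors, the tensor rank of format \<open>(n\<^sup>m, n\<^sup>m, n\<^sup>m)\<close> is at most \<open>C S\<^sup>m\<close>
  with \<open>S\<close> arbitrarily close to the sum in the last inequality, and \<open>m \<rightarrow> \<infinity>\<close> removes \<open>C\<close>.

  Divisions make it impossible to substitute values for inputs of a straight-line program
  over a finite field, so operation counts are compared through tensor rank. A program of size \<open>l\<close>
  bounds the rank over the field \<open>K\<close> of rational functions by \<open>2 l\<close>: the matrices of mixed
  derivatives of its results lie in the span of \<open>2 l\<close> rank-one matrices over \<open>K\<close>. The rank over \<open>K\<close>
  descends to the base field at a subexponential price, because the coefficients of a \<open>t\<close>-th tensor power are
  monomials of degree \<open>t\<close> in finitely many elements of \<open>K\<close>, of which there are only polynomially many
  in \<open>t\<close>. Monotonicity and symmetry of the rank also give the second inequality.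
\<close>

section \<open>Linear algebra of functions into a field\<close>

interpretation fun_space: vector_space "\<lambda>(c::'k::field) (f::'a \<Rightarrow> 'k) x. c * f x"
  by unfold_locales (simp_all add: fun_eq_iff algebra_simps)

interpretation fun_space_pair: vector_space_pair
  "\<lambda>(c::'k::field) (f::'a \<Rightarrow> 'k) x. c * f x" "\<lambda>(c::'k) (f::'b \<Rightarrow> 'k) x. c * f x"
  by unfold_locales

lemma sum_fun_apply: "(\<Sum>a\<in>A. f a) x = (\<Sum>a\<in>A. f a x)"
  for f :: "'a \<Rightarrow> 'b \<Rightarrow> 'c::comm_monoid_add"
  by (induction A rule: infinite_finite_induct) auto

lemma sum_of_bool_mult:
  fixes G :: "'a \<Rightarrow> 'b::semiring_1"
  assumes "finite A" "a \<in> A"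
  shows "(\<Sum>x\<in>A. of_bool (x = a) * G x) = G a" "(\<Sum>x\<in>A. of_bool (a = x) * G x) = G a"
  using assms by simp_all

definition unit_fun :: "'a \<Rightarrow> 'a \<Rightarrow> 'k::field" where
  "unit_fun a = (\<lambda>x. of_bool (x = a))"

lemma finite_support_eq_sum_unit_fun:
  fixes f :: "'a \<Rightarrow> 'k::field"
  assumes "finite A" "\<And>x. x \<notin> A \<Longrightarrow> f x = 0"
  shows "f = (\<Sum>a\<in>A. (\<lambda>x. f a * unit_fun a x))"
proof
  fix x
  show "f x = (\<Sum>a\<in>A. (\<lambda>x. f a * unit_fun a x)) x"
    using assms sum_of_bool_mult(2)[OF assms(1), of x f]
    by (cases "x \<in> A") (auto simp: sum_fun_apply unit_fun_def mult.commute intro!: sum.neutral)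
qed

lemma biorthogonal_card_le:
  fixes X :: "'a \<Rightarrow> 'b \<Rightarrow> 'k::field"
  assumes fin: "finite B"
    and XY: "\<And>a a'. a \<in> A \<Longrightarrow> a' \<in> A \<Longrightarrow> (\<Sum>l\<in>B. X a l * Y l a') = of_bool (a = a')"
  shows "card A \<le> card B"
proof -
  define col where "col a = (\<lambda>l. of_bool (l \<in> B) * Y l a)" for a
  define pairing where "pairing a f = (\<Sum>l\<in>B. X a l * f l)" for a f
  have pairing_col: "pairing a (col a') = of_bool (a = a')" if "a \<in> A" "a' \<in> A" for a a'
    using XY[OF that] by (simp add: pairing_def col_def)
  have "inj_on col A"
    by (rule inj_onI) (metis pairing_col of_bool_eq_iff)
  have "fun_space.independent (col ` A)"
    unfolding fun_space.dependent_def
  proof safe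
    fix a assume a: "a \<in> A" "col a \<in> fun_space.span (col ` A - {col a})"
    have "fun_space.subspace {f. pairing a f = 0}"
      by (simp add: fun_space.subspace_def pairing_def distrib_left sum.distrib
          mult.left_commute flip: sum_distrib_left)
    then have "fun_space.span (col ` A - {col a}) \<subseteq> {f. pairing a f = 0}"
      using a(1) pairing_col by (intro fun_space.span_minimal) auto
    with a pairing_col[of a a] show False by auto
  qed
  moreover have "col ` A \<subseteq> fun_space.span (unit_fun ` B)"
  proof safe
    fix a
    have "(\<Sum>l\<in>B. (\<lambda>m. col a l * unit_fun l m)) \<in> fun_space.span (unit_fun ` B)"
      by (intro fun_space.span_sum fun_space.span_scale fun_space.span_base imageI)
    then show "col a \<in> fun_space.span (unit_fun ` B)"
      using finite_support_eq_sum_unit_fun[OF fin, of "col a"] by (simp add: col_def)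
  qed
  ultimately have "card (col ` A) \<le> card (unit_fun ` B :: ('b \<Rightarrow> 'k) set)"
    using fun_space.independent_span_bound[of "unit_fun ` B" "col ` A"] fin by simp
  also have "\<dots> \<le> card B"
    by (rule card_image_le[OF fin])
  finally show ?thesis
    by (simp add: card_image[OF \<open>inj_on col A\<close>])
qed

lemma injective_left_inverse_coeffs:
  fixes W :: "'a \<Rightarrow> 'b \<Rightarrow> 'k::field"
  assumes finA: "finite A" and finB: "finite B"
    and inj: "\<forall>m. (\<forall>a\<in>A. (\<Sum>b\<in>B. W a b * m b) = 0) \<longrightarrow> (\<forall>b\<in>B. m b = 0)"
  obtains c where "\<forall>b\<in>B. \<forall>b'\<in>B. (\<Sum>a\<in>A. c b a * W a b') = of_bool (b = b')"
proof -
  define S where "S = {m :: 'b \<Rightarrow> 'k. \<forall>b. b \<notin> B \<longrightarrow> m b = 0}"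
  define T where "T m = (\<lambda>a. of_bool (a \<in> A) * (\<Sum>b\<in>B. W a b * m b))" for m
  have S: "fun_space.subspace S"
    unfolding S_def by (auto simp: fun_space.subspace_def)
  have T: "Vector_Spaces.linear (\<lambda>c f x. c * f x) (\<lambda>c f x. c * f x) T"
    by unfold_locales
       (auto simp: T_def fun_eq_iff algebra_simps sum.distrib sum_distrib_left)
  have "inj_on T S"
    unfolding fun_space_pair.linear_inj_on_iff_eq_0[OF T S]
  proof (intro ballI impI)
    fix m assume m: "m \<in> S" "T m = 0"
    have "(\<Sum>b\<in>B. W a b * m b) = 0" if "a \<in> A" for a
      using fun_cong[OF m(2), of a] that by (simp add: T_def)
    then have "m b = 0" if "b \<in> B" for b
      using inj that by blast
    with m(1) show "m = 0"
      by (auto simp: S_def fun_eq_iff)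
  qed
  then obtain g where g: "Vector_Spaces.linear (\<lambda>c f x. c * f x) (\<lambda>c f x. c * f x) g"
    "\<And>m. m \<in> S \<Longrightarrow> g (T m) = m"
    using fun_space_pair.linear_exists_left_inverse_on[OF T S] by blast
  show thesis
  proof (rule that, intro ballI)
    fix b b' assume b: "b \<in> B" "b' \<in> B"
    have "T (unit_fun b') = (\<lambda>a. of_bool (a \<in> A) * W a b')"
      by (simp add: T_def unit_fun_def mult.commute[of "W _ _"] sum_of_bool_mult(1)[OF finB b(2)])
    then have "T (unit_fun b') = (\<Sum>a\<in>A. (\<lambda>x. W a b' * unit_fun a x))"
      using finite_support_eq_sum_unit_fun[OF finA, of "T (unit_fun b')"] by simp
    then have "g (T (unit_fun b')) = (\<Sum>a\<in>A. (\<lambda>y. W a b' * g (unit_fun a) y))"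
      by (simp add: fun_space_pair.linear_sum[OF g(1)] fun_space_pair.linear_scale[OF g(1)])
    moreover have "g (T (unit_fun b')) = unit_fun b'"
      using b by (intro g(2)) (auto simp: S_def unit_fun_def)
    ultimately have "unit_fun b' b = (\<Sum>a\<in>A. g (unit_fun a) b * W a b')"
      by (simp add: sum_fun_apply mult.commute)
    then show "(\<Sum>a\<in>A. g (unit_fun a) b * W a b') = of_bool (b = b')"
      by (simp add: unit_fun_def)
  qed
qed

section \<open>Tensor rank\<close>

text \<open>The set \<open>E\<close> confines the coefficients of the decomposition: finiteness of \<open>E\<close> drives the
  descent to the base field, and \<open>E\<close> consisting of scalars makes the coefficients free in a
  straight-line program.\<close>

definition tensor_decomp ::
    "'k::comm_semiring_1 set \<Rightarrow> 'a set \<Rightarrow> 'b set \<Rightarrow> 'c set \<Rightarrow> ('a \<Rightarrow> 'b \<Rightarrow> 'c \<Rightarrow> 'k) \<Rightarrow>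
     'l set \<Rightarrow> ('l \<Rightarrow> 'a \<Rightarrow> 'k) \<Rightarrow> ('l \<Rightarrow> 'b \<Rightarrow> 'k) \<Rightarrow> ('l \<Rightarrow> 'c \<Rightarrow> 'k) \<Rightarrow> bool" where
  "tensor_decomp E A B C t \<Lambda> f g h \<longleftrightarrow>
     f \<in> \<Lambda> \<rightarrow> A \<rightarrow> E \<and> g \<in> \<Lambda> \<rightarrow> B \<rightarrow> E \<and> h \<in> \<Lambda> \<rightarrow> C \<rightarrow> E \<and>
     (\<forall>a\<in>A. \<forall>b\<in>B. \<forall>c\<in>C. t a b c = (\<Sum>l\<in>\<Lambda>. f l a * g l b * h l c))"

definition tensor_rank_le ::
    "'k::comm_semiring_1 set \<Rightarrow> 'a set \<Rightarrow> 'b set \<Rightarrow> 'c set \<Rightarrow> ('a \<Rightarrow> 'b \<Rightarrow> 'c \<Rightarrow> 'k) \<Rightarrow> nat \<Rightarrow> bool" where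
  "tensor_rank_le E A B C t R \<longleftrightarrow> (\<exists>f g h. tensor_decomp E A B C t {..<R} f g h)"

lemma tensor_rank_leI: "tensor_decomp E A B C t {..<R} f g h \<Longrightarrow> tensor_rank_le E A B C t R"
  unfolding tensor_rank_le_def by blast

lemma tensor_rank_leE:
  assumes "tensor_rank_le E A B C t R"
  obtains f g h where "tensor_decomp E A B C t {..<R} f g h"
  using assms unfolding tensor_rank_le_def by blast

lemma tensor_decomp_eq:
  assumes "tensor_decomp E A B C t \<Lambda> f g h" "a \<in> A" "b \<in> B" "c \<in> C"
  shows "t a b c = (\<Sum>l\<in>\<Lambda>. f l a * g l b * h l c)"
  using assms unfolding tensor_decomp_def by blast

lemma tensor_decomp_imp_rank_le:
  assumes D: "tensor_decomp E A B C t \<Lambda> f g h" and fin: "finite \<Lambda>"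
  shows "tensor_rank_le E A B C t (card \<Lambda>)"
proof -
  obtain \<pi> where \<pi>: "bij_betw \<pi> {..<card \<Lambda>} \<Lambda>"
    using ex_bij_betw_nat_finite[OF fin] by (auto simp: lessThan_atLeast0)
  then have "\<pi> l \<in> \<Lambda>" if "l < card \<Lambda>" for l
    using bij_betwE that by auto
  then have "tensor_decomp E A B C t {..<card \<Lambda>} (\<lambda>l. f (\<pi> l)) (\<lambda>l. g (\<pi> l)) (\<lambda>l. h (\<pi> l))"
    using D sum.reindex_bij_betw[OF \<pi>, of "\<lambda>l. f l _ * g l _ * h l _"]
    by (simp add: tensor_decomp_def Pi_iff)
  then show ?thesis
    by (rule tensor_rank_leI)
qed

lemma tensor_rank_le_coeffs_mono:
  assumes "tensor_rank_le E A B C t R" "E \<subseteq> E'"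
  shows "tensor_rank_le E' A B C t R"
proof -
  from assms(1) obtain f g h where "tensor_decomp E A B C t {..<R} f g h"
    by (rule tensor_rank_leE)
  then have "tensor_decomp E' A B C t {..<R} f g h"
    using assms(2) unfolding tensor_decomp_def by blast
  then show ?thesis
    by (rule tensor_rank_leI)
qed

lemma tensor_rank_le_mono:
  assumes "tensor_rank_le UNIV A B C t R" "R \<le> R'"
  shows "tensor_rank_le UNIV A B C t R'"
proof -
  from assms(1) obtain f g h where D: "tensor_decomp UNIV A B C t {..<R} f g h"
    by (rule tensor_rank_leE)
  have "(\<Sum>l<R'. (if l < R then f l a else 0) * g l b * h l c) = (\<Sum>l<R. f l a * g l b * h l c)" for a b c
    by (rule sum.mono_neutral_cong_right) (use assms(2) in auto)
  then have "tensor_decomp UNIV A B C t {..<R'} (\<lambda>l a. if l < R then f l a else 0) g h"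
    using D by (simp add: tensor_decomp_def)
  then show ?thesis
    by (rule tensor_rank_leI)
qed

lemma tensor_rank_le_finite_coeffs:
  assumes "tensor_rank_le UNIV A B C t R" "finite A" "finite B" "finite C"
  obtains E where "finite E" "tensor_rank_le E A B C t R"
proof -
  from assms(1) obtain f g h where D: "tensor_decomp UNIV A B C t {..<R} f g h"
    by (rule tensor_rank_leE)
  define E where "E = (\<Union>l<R. f l ` A \<union> g l ` B \<union> h l ` C)"
  have "tensor_decomp E A B C t {..<R} f g h"
    using D unfolding tensor_decomp_def E_def by auto
  then have "tensor_rank_le E A B C t R"
    by (rule tensor_rank_leI)
  moreover have "finite E"
    unfolding E_def using assms by auto
  ultimately show thesis by (rule that[rotated])
qed

lemma tensor_rank_le_reindex:
  assumes "tensor_rank_le E A B C t R"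
    and "\<alpha> \<in> A' \<rightarrow> A" "\<beta> \<in> B' \<rightarrow> B" "\<gamma> \<in> C' \<rightarrow> C"
    and "\<And>a b c. a \<in> A' \<Longrightarrow> b \<in> B' \<Longrightarrow> c \<in> C' \<Longrightarrow> t' a b c = t (\<alpha> a) (\<beta> b) (\<gamma> c)"
  shows "tensor_rank_le E A' B' C' t' R"
proof -
  from assms(1) obtain f g h where "tensor_decomp E A B C t {..<R} f g h"
    by (rule tensor_rank_leE)
  then have "tensor_decomp E A' B' C' t' {..<R} (\<lambda>l a. f l (\<alpha> a)) (\<lambda>l b. g l (\<beta> b)) (\<lambda>l c. h l (\<gamma> c))"
    using assms(2-5) by (auto simp: tensor_decomp_def Pi_iff)
  then show ?thesis
    by (rule tensor_rank_leI)
qed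

lemma tensor_rank_le_swap:
  assumes "tensor_rank_le E A B C t R"
  shows "tensor_rank_le E B A C (\<lambda>b a c. t a b c) R"
proof -
  from assms obtain f g h where "tensor_decomp E A B C t {..<R} f g h"
    by (rule tensor_rank_leE)
  then have "tensor_decomp E B A C (\<lambda>b a c. t a b c) {..<R} g f h"
    by (simp add: tensor_decomp_def mult_ac)
  then show ?thesis
    by (rule tensor_rank_leI)
qed

lemma tensor_rank_le_rotate:
  assumes "tensor_rank_le E A B C t R"
  shows "tensor_rank_le E B C A (\<lambda>b c a. t a b c) R"
proof -
  from assms obtain f g h where "tensor_decomp E A B C t {..<R} f g h"
    by (rule tensor_rank_leE)
  then have "tensor_decomp E B C A (\<lambda>b c a. t a b c) {..<R} g h f"
    by (simp add: tensor_decomp_def mult_ac)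
  then show ?thesis
    by (rule tensor_rank_leI)
qed

lemma tensor_rank_le_mult:
  assumes "tensor_rank_le E A B C t R" "tensor_rank_le E' A' B' C' t' R'"
    and E'': "\<And>x y. x \<in> E \<Longrightarrow> y \<in> E' \<Longrightarrow> x * y \<in> E''"
  shows "tensor_rank_le E'' (A \<times> A') (B \<times> B') (C \<times> C')
    (\<lambda>(a, a') (b, b') (c, c'). t a b c * t' a' b' c') (R * R')"
proof -
  from assms(1) obtain f g h where D: "tensor_decomp E A B C t {..<R} f g h"
    by (rule tensor_rank_leE)
  from assms(2) obtain f' g' h' where D': "tensor_decomp E' A' B' C' t' {..<R'} f' g' h'"
    by (rule tensor_rank_leE)
  have "t a b c * t' a' b' c' = (\<Sum>(l, l')\<in>{..<R} \<times> {..<R'}.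
      f l a * f' l' a' * (g l b * g' l' b') * (h l c * h' l' c'))"
    if "a \<in> A" "b \<in> B" "c \<in> C" "a' \<in> A'" "b' \<in> B'" "c' \<in> C'" for a b c a' b' c'
    unfolding tensor_decomp_eq[OF D that(1-3)] tensor_decomp_eq[OF D' that(4-6)]
      sum_product sum.cartesian_product
    by (simp add: case_prod_beta mult_ac)
  then have "tensor_decomp E'' (A \<times> A') (B \<times> B') (C \<times> C') (\<lambda>(a, a') (b, b') (c, c'). t a b c * t' a' b' c')
      ({..<R} \<times> {..<R'}) (\<lambda>(l, l') (a, a'). f l a * f' l' a')
      (\<lambda>(l, l') (b, b'). g l b * g' l' b') (\<lambda>(l, l') (c, c'). h l c * h' l' c')"
    using D D' by (auto simp: tensor_decomp_def Pi_iff case_prod_beta intro!: E'')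
  then show ?thesis
    using tensor_decomp_imp_rank_le by fastforce
qed

lemma tensor_rank_le_sum:
  assumes fin: "finite I" and t: "\<And>i. i \<in> I \<Longrightarrow> tensor_rank_le UNIV A B C (t i) (\<rho> i)"
  shows "tensor_rank_le UNIV A B C (\<lambda>a b c. \<Sum>i\<in>I. t i a b c) (\<Sum>i\<in>I. \<rho> i)"
proof -
  have "\<forall>i\<in>I. \<exists>f g h. tensor_decomp UNIV A B C (t i) {..<\<rho> i} f g h"
    using t unfolding tensor_rank_le_def by blast
  then obtain f g h where D: "\<And>i. i \<in> I \<Longrightarrow> tensor_decomp UNIV A B C (t i) {..<\<rho> i} (f i) (g i) (h i)"
    by metis
  have "tensor_decomp UNIV A B C (\<lambda>a b c. \<Sum>i\<in>I. t i a b c) (SIGMA i:I. {..<\<rho> i})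
      (\<lambda>(i, l). f i l) (\<lambda>(i, l). g i l) (\<lambda>(i, l). h i l)"
    using fin by (simp add: tensor_decomp_def tensor_decomp_eq[OF D] sum.Sigma case_prod_beta)
  then show ?thesis
    using tensor_decomp_imp_rank_le fin by fastforce
qed

lemma tensor_rank_le_restrict:
  assumes "tensor_rank_le UNIV A B C t R"
    and "\<And>a u. a \<in> A' \<Longrightarrow> u \<in> U \<Longrightarrow> \<alpha> a u \<in> A" "\<And>b v. b \<in> B' \<Longrightarrow> v \<in> V \<Longrightarrow> \<beta> b v \<in> B"
    and "\<And>c w. c \<in> C' \<Longrightarrow> w \<in> W \<Longrightarrow> \<gamma> c w \<in> C"
  shows "tensor_rank_le UNIV A' B' C'
    (\<lambda>a b c. \<Sum>u\<in>U. \<Sum>v\<in>V. \<Sum>w\<in>W. x a u * y b v * z c w * t (\<alpha> a u) (\<beta> b v) (\<gamma> c w)) R"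
proof -
  from assms(1) obtain f g h where D: "tensor_decomp UNIV A B C t {..<R} f g h"
    by (rule tensor_rank_leE)
  have "(\<Sum>u\<in>U. \<Sum>v\<in>V. \<Sum>w\<in>W. x a u * y b v * z c w * t (\<alpha> a u) (\<beta> b v) (\<gamma> c w))
      = (\<Sum>l<R. (\<Sum>u\<in>U. x a u * f l (\<alpha> a u)) * (\<Sum>v\<in>V. y b v * g l (\<beta> b v)) * (\<Sum>w\<in>W. z c w * h l (\<gamma> c w)))"
    if "a \<in> A'" "b \<in> B'" "c \<in> C'" for a b c
  proof -
    let ?F = "\<lambda>l u. x a u * f l (\<alpha> a u)" and ?G = "\<lambda>l v. y b v * g l (\<beta> b v)"
      and ?H = "\<lambda>l w. z c w * h l (\<gamma> c w)"
    have "(\<Sum>u\<in>U. \<Sum>v\<in>V. \<Sum>w\<in>W. x a u * y b v * z c w * t (\<alpha> a u) (\<beta> b v) (\<gamma> c w))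
      = (\<Sum>u\<in>U. \<Sum>v\<in>V. \<Sum>w\<in>W. \<Sum>l<R. ?F l u * ?G l v * ?H l w)"
      using assms that by (intro sum.cong refl) (simp add: tensor_decomp_eq[OF D] sum_distrib_left mult_ac)
    also have "\<dots> = (\<Sum>l<R. \<Sum>u\<in>U. \<Sum>v\<in>V. \<Sum>w\<in>W. ?F l u * ?G l v * ?H l w)"
      by (simp only: sum.swap[of _ "{..<R}"])
    also have "\<dots> = (\<Sum>l<R. (\<Sum>u\<in>U. ?F l u) * (\<Sum>v\<in>V. ?G l v) * (\<Sum>w\<in>W. ?H l w))"
      by (simp only: sum_distrib_left[symmetric] sum_distrib_right[symmetric])
    finally show ?thesis .
  qed
  then have "tensor_decomp UNIV A' B' C'
    (\<lambda>a b c. \<Sum>u\<in>U. \<Sum>v\<in>V. \<Sum>w\<in>W. x a u * y b v * z c w * t (\<alpha> a u) (\<beta> b v) (\<gamma> c w)) {..<R}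
    (\<lambda>l a. \<Sum>u\<in>U. x a u * f l (\<alpha> a u)) (\<lambda>l b. \<Sum>v\<in>V. y b v * g l (\<beta> b v)) (\<lambda>l c. \<Sum>w\<in>W. z c w * h l (\<gamma> c w))"
    unfolding tensor_decomp_def by auto
  then show ?thesis
    by (rule tensor_rank_leI)
qed

lemma tensor_rank_le_hom:
  fixes \<phi> :: "'k::comm_semiring_1 \<Rightarrow> 'm::comm_semiring_1"
  assumes "tensor_rank_le E A B C t R"
    and \<phi>: "\<phi> 0 = 0" "\<And>x y. \<phi> (x + y) = \<phi> x + \<phi> y" "\<And>x y. \<phi> (x * y) = \<phi> x * \<phi> y"
  shows "tensor_rank_le (\<phi> ` E) A B C (\<lambda>a b c. \<phi> (t a b c)) R"
proof -
  from assms(1) obtain f g h where "tensor_decomp E A B C t {..<R} f g h"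
    by (rule tensor_rank_leE)
  moreover have "\<phi> (sum s \<Lambda>) = (\<Sum>l\<in>\<Lambda>. \<phi> (s l))" for s and \<Lambda> :: "nat set"
    by (induction \<Lambda> rule: infinite_finite_induct) (simp_all add: \<phi>)
  ultimately have "tensor_decomp (\<phi> ` E) A B C (\<lambda>a b c. \<phi> (t a b c)) {..<R}
      (\<lambda>l a. \<phi> (f l a)) (\<lambda>l b. \<phi> (g l b)) (\<lambda>l c. \<phi> (h l c))"
    by (auto simp: tensor_decomp_def Pi_iff \<phi>)
  then show ?thesis
    by (rule tensor_rank_leI)
qed

text \<open>The coefficients take only values in the finite set \<open>E\<close>, so they are combinations of elements of
  \<open>E\<close> with coefficients 0 and 1; the additive map \<open>\<phi>\<close> then only has to evaluate triple products.\<close>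

lemma tensor_rank_le_additive_image:
  fixes \<phi> :: "'k::comm_semiring_1 \<Rightarrow> 'm::comm_semiring_1"
  assumes "tensor_rank_le E A B C t R" and fin: "finite E"
    and \<phi>: "\<phi> 0 = 0" "\<And>x y. \<phi> (x + y) = \<phi> x + \<phi> y"
  shows "tensor_rank_le UNIV A B C (\<lambda>a b c. \<phi> (t a b c)) (R * card E ^ 3)"
proof -
  from assms(1) obtain f g h where D: "tensor_decomp E A B C t {..<R} f g h"
    by (rule tensor_rank_leE)
  have \<phi>_sum: "\<phi> (sum s \<Lambda>) = (\<Sum>l\<in>\<Lambda>. \<phi> (s l))" for s and \<Lambda> :: "nat set"
    by (induction \<Lambda> rule: infinite_finite_induct) (simp_all add: \<phi>)
  let ?F = "\<lambda>(l, x, y, z) a. of_bool (f l a = x) :: 'm"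
  let ?G = "\<lambda>(l, x, y, z) b. of_bool (g l b = y) :: 'm"
  let ?H = "\<lambda>(l, x, y, z) c. of_bool (h l c = z) * \<phi> (x * y * z)"
  let ?\<Lambda> = "{..<R} \<times> E \<times> E \<times> E"
  have "\<phi> (t a b c) = (\<Sum>m\<in>?\<Lambda>. ?F m a * ?G m b * ?H m c)" if abc: "a \<in> A" "b \<in> B" "c \<in> C" for a b c
  proof -
    have "\<phi> (t a b c) = (\<Sum>l<R. \<phi> (f l a * g l b * h l c))"
      by (simp add: tensor_decomp_eq[OF D abc] \<phi>_sum)
    also have "\<dots> = (\<Sum>l<R. \<Sum>x\<in>E. of_bool (f l a = x) * (\<Sum>y\<in>E. of_bool (g l b = y) *
        (\<Sum>z\<in>E. of_bool (h l c = z) * \<phi> (x * y * z))))"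
    proof (rule sum.cong[OF refl])
      fix l assume "l \<in> {..<R}"
      then have "f l a \<in> E" "g l b \<in> E" "h l c \<in> E"
        using D abc by (auto simp: tensor_decomp_def Pi_iff)
      then show "\<phi> (f l a * g l b * h l c) = (\<Sum>x\<in>E. of_bool (f l a = x) *
          (\<Sum>y\<in>E. of_bool (g l b = y) * (\<Sum>z\<in>E. of_bool (h l c = z) * \<phi> (x * y * z))))"
        by (simp only: sum_of_bool_mult(2)[OF fin])
    qed
    also have "\<dots> = (\<Sum>m\<in>?\<Lambda>. ?F m a * ?G m b * ?H m c)"
      unfolding sum_distrib_left sum.cartesian_product
      by (rule sum.cong) (auto simp: mult.assoc)
    finally show ?thesis .
  qed
  then have "tensor_decomp UNIV A B C (\<lambda>a b c. \<phi> (t a b c)) ?\<Lambda> ?F ?G ?H"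
    unfolding tensor_decomp_def by blast
  from tensor_decomp_imp_rank_le[OF this] fin show ?thesis
    by (simp add: power3_eq_cube mult.assoc)
qed

lemma card_le_tensor_rank:
  fixes t :: "'a \<Rightarrow> 'b \<Rightarrow> 'c \<Rightarrow> 'k::field"
  assumes "tensor_rank_le E A B C t R" and "\<beta> \<in> A \<rightarrow> B" "\<gamma> \<in> A \<rightarrow> C"
    and "\<And>a a'. a \<in> A \<Longrightarrow> a' \<in> A \<Longrightarrow> t a (\<beta> a') (\<gamma> a') = of_bool (a = a')"
  shows "card A \<le> R"
proof -
  from assms(1) obtain f g h where D: "tensor_decomp E A B C t {..<R} f g h"
    by (rule tensor_rank_leE)
  have "card A \<le> card {..<R}"
  proof (rule biorthogonal_card_le)
    fix a a' assume a: "a \<in> A" "a' \<in> A"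
    then have "of_bool (a = a') = t a (\<beta> a') (\<gamma> a')" by (simp add: assms(4))
    also have "\<dots> = (\<Sum>l<R. f l a * (g l (\<beta> a') * h l (\<gamma> a')))"
      using a assms(2,3) by (subst tensor_decomp_eq[OF D]) (auto simp: mult.assoc)
    finally show "(\<Sum>l<R. f l a * (g l (\<beta> a') * h l (\<gamma> a'))) = of_bool (a = a')" ..
  qed simp
  then show ?thesis by simp
qed

lemma tensor_decomp_apply:
  assumes D: "tensor_decomp E A B C t \<Lambda> f g h" and c: "c \<in> C"
  shows "(\<Sum>l\<in>\<Lambda>. h l c * ((\<Sum>a\<in>A. f l a * x a) * (\<Sum>b\<in>B. g l b * y b)))
    = (\<Sum>a\<in>A. \<Sum>b\<in>B. t a b c * (x a * y b))"
proof -
  have "(\<Sum>l\<in>\<Lambda>. h l c * ((\<Sum>a\<in>A. f l a * x a) * (\<Sum>b\<in>B. g l b * y b)))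
      = (\<Sum>l\<in>\<Lambda>. \<Sum>a\<in>A. \<Sum>b\<in>B. f l a * g l b * h l c * (x a * y b))"
    unfolding sum_product unfolding sum_distrib_left by (intro sum.cong refl) (simp add: mult_ac)
  also have "\<dots> = (\<Sum>a\<in>A. \<Sum>l\<in>\<Lambda>. \<Sum>b\<in>B. f l a * g l b * h l c * (x a * y b))"
    by (rule sum.swap)
  also have "\<dots> = (\<Sum>a\<in>A. \<Sum>b\<in>B. \<Sum>l\<in>\<Lambda>. f l a * g l b * h l c * (x a * y b))"
    by (intro sum.cong refl sum.swap)
  also have "\<dots> = (\<Sum>a\<in>A. \<Sum>b\<in>B. t a b c * (x a * y b))"
    by (intro sum.cong refl) (simp add: tensor_decomp_eq[OF D _ _ c] sum_distrib_right)
  finally show ?thesis .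
qed

section \<open>The matrix multiplication tensor\<close>

definition matmul_tensor :: "'i \<times> 'j \<Rightarrow> 'j \<times> 'l \<Rightarrow> 'i \<times> 'l \<Rightarrow> 'k::zero_neq_one" where
  "matmul_tensor = (\<lambda>(i, j) (j', k) (i', k'). of_bool (i = i' \<and> j = j' \<and> k = k'))"

lemma matmul_tensor_apply [simp]:
  "matmul_tensor (i, j) (j', k) (i', k') = of_bool (i = i' \<and> j = j' \<and> k = k')"
  by (simp add: matmul_tensor_def)

definition matmul_rank_le :: "'k::comm_semiring_1 set \<Rightarrow> nat \<Rightarrow> nat \<Rightarrow> nat \<Rightarrow> nat \<Rightarrow> bool" where
  "matmul_rank_le E p q r R \<longleftrightarrow>
     tensor_rank_le E ({..<p} \<times> {..<q}) ({..<q} \<times> {..<r}) ({..<p} \<times> {..<r}) matmul_tensor R"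

lemma matmul_rank_le_coeffs_mono:
  "matmul_rank_le E p q r R \<Longrightarrow> E \<subseteq> E' \<Longrightarrow> matmul_rank_le E' p q r R"
  unfolding matmul_rank_le_def by (rule tensor_rank_le_coeffs_mono)

lemma matmul_rank_le_mono:
  assumes "matmul_rank_le (UNIV :: 'k::comm_semiring_1 set) p q r R" "R \<le> R'"
  shows "matmul_rank_le (UNIV :: 'k set) p q r R'"
  using assms unfolding matmul_rank_le_def by (rule tensor_rank_le_mono)

lemma matmul_rank_le_antimono:
  assumes "matmul_rank_le E p q r R" "p' \<le> p" "q' \<le> q" "r' \<le> r"
  shows "matmul_rank_le E p' q' r' R"
  unfolding matmul_rank_le_def
  by (rule tensor_rank_le_reindex[OF assms(1)[unfolded matmul_rank_le_def], of id _ id _ id])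
     (use assms(2-4) in auto)

lemma matmul_rank_le_rotate:
  assumes "matmul_rank_le E p q r R"
  shows "matmul_rank_le E q r p R"
  unfolding matmul_rank_le_def
  by (rule tensor_rank_le_reindex[OF tensor_rank_le_rotate[OF assms[unfolded matmul_rank_le_def]],
        of id _ prod.swap _ prod.swap]) auto

lemma matmul_rank_le_transpose:
  assumes "matmul_rank_le E p q r R"
  shows "matmul_rank_le E r q p R"
  unfolding matmul_rank_le_def
  by (rule tensor_rank_le_reindex[OF tensor_rank_le_swap[OF assms[unfolded matmul_rank_le_def]],
        of prod.swap _ prod.swap _ prod.swap]) auto

lemma matmul_rank_le_1: "matmul_rank_le {1} 1 1 1 1"
proof -
  have "tensor_decomp {1 :: 'a} ({..<1} \<times> {..<1}) ({..<1} \<times> {..<1}) ({..<1} \<times> {..<1}) matmul_tensor {..<1}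
      (\<lambda>(_ :: nat) (_ :: nat \<times> nat). 1) (\<lambda>_ (_ :: nat \<times> nat). 1) (\<lambda>_ (_ :: nat \<times> nat). 1)"
    by (auto simp: tensor_decomp_def)
  then show ?thesis
    unfolding matmul_rank_le_def by (rule tensor_rank_leI)
qed

lemma div_mod_eq_iff: "x = y \<longleftrightarrow> x div m = y div m \<and> x mod m = y mod m" for x y m :: nat
  by (metis div_mult_mod_eq)

lemma matmul_rank_le_mult:
  assumes "matmul_rank_le E p q r R" "matmul_rank_le E' p' q' r' R'"
    and "\<And>x y. x \<in> E \<Longrightarrow> y \<in> E' \<Longrightarrow> x * y \<in> E''"
  shows "matmul_rank_le E'' (p * p') (q * q') (r * r') (R * R')"
proof -
  define split :: "nat \<Rightarrow> nat \<Rightarrow> nat \<times> nat \<Rightarrow> (nat \<times> nat) \<times> (nat \<times> nat)"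
    where "split m n = (\<lambda>(i, j). ((i div m, j div n), (i mod m, j mod n)))" for m n
  have split_mem: "split m' n' \<in> {..<m * m'} \<times> {..<n * n'} \<rightarrow> ({..<m} \<times> {..<n}) \<times> ({..<m'} \<times> {..<n'})"
    for m m' n n'
    by (auto simp: split_def less_mult_imp_div_less intro!: mod_less_divisor gr0I)
  have factor: "matmul_tensor (i, j) (j', k) (i', k') =
      (matmul_tensor (i div p', j div q') (j' div q', k div r') (i' div p', k' div r')
       * matmul_tensor (i mod p', j mod q') (j' mod q', k mod r') (i' mod p', k' mod r') :: 'a)"
    for i j j' k i' k'
    unfolding matmul_tensor_apply of_bool_conj[symmetric]
      div_mod_eq_iff[of i i' p'] div_mod_eq_iff[of j j' q'] div_mod_eq_iff[of k k' r']
    by (rule arg_cong[of _ _ of_bool]) (simp only: conj_ac)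
  show ?thesis
    unfolding matmul_rank_le_def
    by (rule tensor_rank_le_reindex[OF tensor_rank_le_mult[OF assms[unfolded matmul_rank_le_def]]
            split_mem split_mem split_mem])
       (auto simp: split_def factor[symmetric] simp del: matmul_tensor_apply)
qed

lemma matmul_rank_le_prod:
  assumes "finite I"
    and "\<And>i. i \<in> I \<Longrightarrow> matmul_rank_le (UNIV :: 'k::comm_semiring_1 set) (p i) (q i) (r i) (\<rho> i)"
  shows "matmul_rank_le (UNIV :: 'k set) (\<Prod>i\<in>I. p i) (\<Prod>i\<in>I. q i) (\<Prod>i\<in>I. r i) (\<Prod>i\<in>I. \<rho> i)"
  using assms
proof (induction I rule: finite_induct)
  case empty
  then show ?case
    using matmul_rank_le_coeffs_mono[OF matmul_rank_le_1, of UNIV] by simp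
next
  case (insert i I)
  then have "matmul_rank_le (UNIV :: 'k set) (p i * (\<Prod>i\<in>I. p i)) (q i * (\<Prod>i\<in>I. q i))
      (r i * (\<Prod>i\<in>I. r i)) (\<rho> i * (\<Prod>i\<in>I. \<rho> i))"
    by (intro matmul_rank_le_mult[of UNIV _ _ _ _ UNIV]) auto
  then show ?case
    using insert.hyps by simp
qed

lemma matmul_rank_le_prod_floor:
  fixes B :: "'i \<Rightarrow> real"
  assumes "finite I" and B: "\<And>i. i \<in> I \<Longrightarrow> B i \<ge> 0"
    and "\<And>i. i \<in> I \<Longrightarrow> matmul_rank_le (UNIV :: 'k::comm_semiring_1 set) (p i) (q i) (r i) (nat \<lfloor>B i\<rfloor>)"
  shows "matmul_rank_le (UNIV :: 'k set) (\<Prod>i\<in>I. p i) (\<Prod>i\<in>I. q i) (\<Prod>i\<in>I. r i) (nat \<lfloor>\<Prod>i\<in>I. B i\<rfloor>)"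
proof (rule matmul_rank_le_mono[OF matmul_rank_le_prod])
  have "real (\<Prod>i\<in>I. nat \<lfloor>B i\<rfloor>) \<le> (\<Prod>i\<in>I. B i)"
    unfolding of_nat_prod using B by (intro prod_mono) auto
  then show "(\<Prod>i\<in>I. nat \<lfloor>B i\<rfloor>) \<le> nat \<lfloor>\<Prod>i\<in>I. B i\<rfloor>"
    by (rule le_nat_floor)
qed (use assms in auto)

lemma matmul_rank_le_hom:
  assumes "matmul_rank_le E p q r R"
    and "\<phi> 0 = 0" "\<phi> 1 = 1" "\<And>x y. \<phi> (x + y) = \<phi> x + \<phi> y" "\<And>x y. \<phi> (x * y) = \<phi> x * \<phi> y"
  shows "matmul_rank_le (\<phi> ` E) p q r R"
  using tensor_rank_le_hom[OF assms(1)[unfolded matmul_rank_le_def] assms(2,4,5)]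
  unfolding matmul_rank_le_def
  by (rule tensor_rank_le_reindex[of _ _ _ _ _ _ id _ id _ id]) (auto simp: of_bool_def assms(2,3))

lemma matmul_rank_le_additive_image:
  fixes E :: "'k::comm_semiring_1 set" and \<phi> :: "'k \<Rightarrow> 'm::comm_semiring_1"
  assumes "matmul_rank_le E p q r R" "finite E"
    and "\<phi> 0 = 0" "\<phi> 1 = 1" "\<And>x y. \<phi> (x + y) = \<phi> x + \<phi> y"
  shows "matmul_rank_le (UNIV :: 'm set) p q r (R * card E ^ 3)"
  using tensor_rank_le_additive_image[OF assms(1)[unfolded matmul_rank_le_def] assms(2,3,5)]
  unfolding matmul_rank_le_def
  by (rule tensor_rank_le_reindex[of _ _ _ _ _ _ id _ id _ id]) (auto simp: of_bool_def assms(3,4))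

lemma matmul_rank_ge_left:
  fixes E :: "'k::field set"
  assumes "matmul_rank_le E p q r R" "r > 0"
  shows "p * q \<le> R"
proof -
  have "card ({..<p} \<times> {..<q}) \<le> R"
    by (rule card_le_tensor_rank[OF assms(1)[unfolded matmul_rank_le_def],
          of "\<lambda>(i, j). (j, 0)" "\<lambda>(i, j). (i, 0)"])
       (use assms(2) in auto)
  then show ?thesis by simp
qed

lemma matmul_rank_ge:
  fixes E :: "'k::field set"
  assumes "matmul_rank_le E p q r R" "p > 0" "q > 0" "r > 0"
  shows "p * q \<le> R" "q * r \<le> R" "p * r \<le> R"
  using matmul_rank_ge_left[OF assms(1,4)]
    matmul_rank_ge_left[OF matmul_rank_le_rotate[OF assms(1)] assms(2)]
    matmul_rank_ge_left[OF matmul_rank_le_rotate[OF matmul_rank_le_rotate[OF assms(1)]] assms(3)]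
  by (simp_all add: mult.commute)

lemma sum_matmul_tensor:
  fixes x y :: "nat \<times> nat \<Rightarrow> 'k::comm_semiring_1"
  assumes "i < p" "k < r"
  shows "(\<Sum>a\<in>{..<p} \<times> {..<q}. \<Sum>b\<in>{..<q} \<times> {..<r}. matmul_tensor a b (i, k) * (x a * y b))
    = (\<Sum>j<q. x (i, j) * y (j, k))"
proof -
  have "(\<Sum>a\<in>{..<p} \<times> {..<q}. \<Sum>b\<in>{..<q} \<times> {..<r}. matmul_tensor a b (i, k) * (x a * y b))
    = (\<Sum>i'<p. of_bool (i' = i) * (\<Sum>j<q. \<Sum>j'<q. of_bool (j' = j) *
        (\<Sum>k'<r. of_bool (k' = k) * (x (i', j) * y (j', k')))))"
    unfolding sum.cartesian_product' sum_distrib_left by (intro sum.cong refl) auto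
  also have "\<dots> = (\<Sum>j<q. x (i, j) * y (j, k))"
    using assms by (simp add: sum_of_bool_mult(1))
  finally show ?thesis .
qed

section \<open>From straight-line programs to tensor rank\<close>

definition derivation :: "('a::comm_ring_1 \<Rightarrow> 'a) \<Rightarrow> bool" where
  "derivation D \<longleftrightarrow> (\<forall>x y. D (x + y) = D x + D y) \<and> (\<forall>x y. D (x * y) = x * D y + y * D x)"

lemma derivation_add: "derivation D \<Longrightarrow> D (x + y) = D x + D y"
  and derivation_mult: "derivation D \<Longrightarrow> D (x * y) = x * D y + y * D x"
  unfolding derivation_def by blast+

lemma derivation_0 [simp]: "derivation D \<Longrightarrow> D 0 = 0"
  using derivation_add[of D 0 0] by simp

lemma derivation_1 [simp]: "derivation D \<Longrightarrow> D 1 = 0"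
  using derivation_mult[of D 1 1] by simp

lemma derivation_diff: "derivation D \<Longrightarrow> D (x - y) = D x - D y"
  using derivation_add[of D "x - y" y] by (simp add: algebra_simps)

lemma derivation_sum: "derivation D \<Longrightarrow> D (sum t A) = (\<Sum>x\<in>A. D (t x))"
  by (induction A rule: infinite_finite_induct) (simp_all add: derivation_add)

lemma derivation_scale: "derivation D \<Longrightarrow> derivation (\<lambda>x. c * D x)"
  unfolding derivation_def by (auto simp: algebra_simps)

definition fract_deriv :: "('a::idom \<Rightarrow> 'a) \<Rightarrow> 'a fract \<Rightarrow> 'a fract" where
  "fract_deriv d x =
     (THE y. \<exists>a b. b \<noteq> 0 \<and> x = Fract a b \<and> y = Fract (b * d a - a * d b) (b * b))"

lemma derivation_quotient_rule_cong:
  fixes d :: "'a::idom \<Rightarrow> 'a"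
  assumes d: "derivation d" and ab: "a * b' = a' * b"
  shows "(b * d a - a * d b) * (b' * b') = (b' * d a' - a' * d b') * (b * b)"
proof -
  have dab: "a * d b' + b' * d a = a' * d b + b * d a'"
    using arg_cong[OF ab, of d] by (simp add: derivation_mult[OF d])
  then have da: "b' * d a = a' * d b + b * d a' - a * d b'"
    by (simp add: algebra_simps)
  have "(b * d a - a * d b) * (b' * b') = b * b' * (b' * d a) - a * b' * (b' * d b)"
    by (simp add: algebra_simps)
  also have "\<dots> = b * b' * (a' * d b + b * d a' - a * d b') - a' * b * (b' * d b)"
    by (simp only: da ab)
  also have "\<dots> = b * b' * (b * d a') - b * d b' * (a * b')"
    by (simp add: algebra_simps)
  also have "\<dots> = (b' * d a' - a' * d b') * (b * b)"
    unfolding ab by (simp add: algebra_simps)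
  finally show ?thesis .
qed

lemma fract_deriv_Fract:
  fixes d :: "'a::idom \<Rightarrow> 'a"
  assumes d: "derivation d" and b: "b \<noteq> 0"
  shows "fract_deriv d (Fract a b) = Fract (b * d a - a * d b) (b * b)"
  unfolding fract_deriv_def
proof (rule the_equality)
  fix y assume "\<exists>a' b'. b' \<noteq> 0 \<and> Fract a b = Fract a' b' \<and> y = Fract (b' * d a' - a' * d b') (b' * b')"
  then obtain a' b' where "b' \<noteq> 0" "Fract a b = Fract a' b'" "y = Fract (b' * d a' - a' * d b') (b' * b')"
    by blast
  with b derivation_quotient_rule_cong[OF d, of a b' a' b]
  show "y = Fract (b * d a - a * d b) (b * b)"
    by (simp add: eq_fract)
qed (use b in blast)

lemma derivation_fract_deriv:
  fixes d :: "'a::idom \<Rightarrow> 'a"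
  assumes d: "derivation d"
  shows "derivation (fract_deriv d)"
  unfolding derivation_def
proof (intro conjI allI)
  note rules = fract_deriv_Fract[OF d] derivation_mult[OF d] derivation_add[OF d] eq_fract
  fix x y :: "'a fract"
  obtain a b where x: "x = Fract a b" "b \<noteq> 0" by (cases x)
  obtain a' b' where y: "y = Fract a' b'" "b' \<noteq> 0" by (cases y)
  show "fract_deriv d (x + y) = fract_deriv d x + fract_deriv d y"
    using x y by (simp add: rules) (simp add: algebra_simps)
  show "fract_deriv d (x * y) = x * fract_deriv d y + y * fract_deriv d x"
    using x y by (simp add: rules) (simp add: algebra_simps)
qed

text \<open>The Euler operator \<open>x\<^sub>v \<partial>/\<partial>x\<^sub>v\<close> only scales monomials; dividing by \<open>x\<^sub>v\<close> in the field
  of rational functions recovers the partial derivative without subtracting exponents.\<close>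

lift_definition euler_deriv :: "'v \<Rightarrow> (('v \<Rightarrow>\<^sub>0 nat) \<Rightarrow>\<^sub>0 'a::comm_ring_1) \<Rightarrow> ('v \<Rightarrow>\<^sub>0 nat) \<Rightarrow>\<^sub>0 'a"
  is "\<lambda>v p m. of_nat (Poly_Mapping.lookup m v) * p m"
  by (rule finite_subset[rotated]) auto

lemma euler_deriv_single:
  "euler_deriv v (Poly_Mapping.single m c) = Poly_Mapping.single m (of_nat (Poly_Mapping.lookup m v) * c)"
  by (rule poly_mapping_eqI) (simp add: euler_deriv.rep_eq lookup_single when_def)

lemma euler_deriv_add: "euler_deriv v (p + q) = euler_deriv v p + euler_deriv v q"
  by (rule poly_mapping_eqI) (simp add: euler_deriv.rep_eq lookup_add algebra_simps)

lemma poly_mapping_induct_monomials [case_names single add]: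
  fixes p :: "'a \<Rightarrow>\<^sub>0 'b::comm_monoid_add"
  assumes "\<And>m c. P (Poly_Mapping.single m c)" and "\<And>p q. P p \<Longrightarrow> P q \<Longrightarrow> P (p + q)"
  shows "P p"
proof -
  have "P (\<Sum>m\<in>A. Poly_Mapping.single m (Poly_Mapping.lookup p m))" if "finite A" for A
    using that assms(1)[of _ 0] by (induction A) (auto intro: assms)
  moreover have "p = (\<Sum>m\<in>Poly_Mapping.keys p. Poly_Mapping.single m (Poly_Mapping.lookup p m))"
    by (rule poly_mapping_eqI)
       (auto simp: lookup_sum lookup_single when_def sum.delta in_keys_iff)
  ultimately show ?thesis by (metis finite_keys)
qed

lemma derivation_euler_deriv: "derivation (euler_deriv v)"
proof -
  have "euler_deriv v (p * q) = p * euler_deriv v q + q * euler_deriv v p" for p q :: "('a \<Rightarrow>\<^sub>0 nat) \<Rightarrow>\<^sub>0 'b"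
  proof (induction p rule: poly_mapping_induct_monomials)
    case (single m c)
    show ?case
    proof (induction q rule: poly_mapping_induct_monomials)
      case (single m' c')
      show ?case
        by (simp add: mult_single euler_deriv_single lookup_add single_add[symmetric] algebra_simps)
    qed (simp add: euler_deriv_add algebra_simps)
  qed (simp add: euler_deriv_add algebra_simps)
  then show ?thesis
    unfolding derivation_def by (simp add: euler_deriv_add)
qed

definition rf_deriv :: "nat \<Rightarrow> 'f::field ratfun \<Rightarrow> 'f ratfun" where
  "rf_deriv v x = inverse (rf_var v) * fract_deriv (euler_deriv v) x"

lemma derivation_rf_deriv: "derivation (rf_deriv v)"
  unfolding rf_deriv_def[abs_def]
  by (intro derivation_scale derivation_fract_deriv derivation_euler_deriv)

lemma fract_deriv_euler_deriv_Fract_1: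
  "fract_deriv (euler_deriv v) (Fract p 1) = Fract (euler_deriv v p) 1"
  by (simp add: fract_deriv_Fract derivation_euler_deriv)

lemma rf_deriv_const [simp]: "rf_deriv v (rf_const c) = 0"
  by (simp add: rf_deriv_def rf_const_def fract_deriv_euler_deriv_Fract_1 euler_deriv_single Zero_fract_def)

lemma rf_var_nonzero: "rf_var v \<noteq> (0 :: 'f::field ratfun)"
proof
  assume "rf_var v = (0 :: 'f ratfun)"
  then have "Poly_Mapping.single (Poly_Mapping.single v (1::nat)) (1::'f) = 0"
    unfolding rf_var_def Zero_fract_def by (simp add: eq_fract)
  then show False
    using lookup_single_eq[of "Poly_Mapping.single v (1::nat)" "1::'f"] by simp
qed

lemma rf_deriv_var [simp]: "rf_deriv v (rf_var u :: 'f::field ratfun) = of_bool (u = v)"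
proof -
  have "fract_deriv (euler_deriv v) (rf_var u :: 'f ratfun) = of_bool (u = v) * rf_var u"
    by (simp add: rf_var_def fract_deriv_euler_deriv_Fract_1 euler_deriv_single lookup_single
        when_def Zero_fract_def)
  then show ?thesis
    using rf_var_nonzero[of v, where 'f = 'f] by (simp add: rf_deriv_def)
qed

definition mixed_deriv :: "('u \<Rightarrow> 'k \<Rightarrow> 'k) \<Rightarrow> ('v \<Rightarrow> 'k \<Rightarrow> 'k) \<Rightarrow> 'k \<Rightarrow> 'u \<times> 'v \<Rightarrow> 'k" where
  "mixed_deriv D D' x = (\<lambda>(u, v). D u (D' v x))"

definition outer_product :: "('u \<Rightarrow> 'k) \<Rightarrow> ('v \<Rightarrow> 'k) \<Rightarrow> 'u \<times> 'v \<Rightarrow> 'k::times" where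
  "outer_product f g = (\<lambda>(u, v). f u * g v)"

definition rank_one :: "('u \<times> 'v \<Rightarrow> 'k::times) set" where
  "rank_one = {outer_product f g |f g. True}"

context
  fixes D :: "'u \<Rightarrow> 'k::field \<Rightarrow> 'k" and D' :: "'v \<Rightarrow> 'k \<Rightarrow> 'k"
  assumes D: "\<And>u. derivation (D u)" and D': "\<And>v. derivation (D' v)"
begin

lemma mixed_deriv_add: "mixed_deriv D D' (x + y) = mixed_deriv D D' x + mixed_deriv D D' y"
  and mixed_deriv_diff: "mixed_deriv D D' (x - y) = mixed_deriv D D' x - mixed_deriv D D' y"
  by (simp_all add: mixed_deriv_def fun_eq_iff derivation_add[OF D] derivation_add[OF D']
      derivation_diff[OF D] derivation_diff[OF D'])

lemma mixed_deriv_mult: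
  "mixed_deriv D D' (x * y) =
     (\<lambda>p. x * mixed_deriv D D' y p) + (\<lambda>p. y * mixed_deriv D D' x p) +
     outer_product (\<lambda>u. D u x) (\<lambda>v. D' v y) + outer_product (\<lambda>u. D u y) (\<lambda>v. D' v x)"
  by (simp add: mixed_deriv_def outer_product_def fun_eq_iff derivation_add[OF D]
      derivation_mult[OF D] derivation_mult[OF D'] algebra_simps)

lemma mixed_deriv_mult_span:
  fixes y b :: 'k and T :: "('u \<times> 'v \<Rightarrow> 'k) set"
  defines "\<tau> \<equiv> outer_product (\<lambda>u. D u y) (\<lambda>v. D' v b)" and "\<tau>' \<equiv> outer_product (\<lambda>u. D u b) (\<lambda>v. D' v y)"
  defines "V \<equiv> fun_space.span (insert \<tau> (insert \<tau>' T))"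
  assumes b: "mixed_deriv D D' b \<in> V"
  shows "mixed_deriv D D' y \<in> V \<Longrightarrow> mixed_deriv D D' (y * b) \<in> V"
    and "mixed_deriv D D' (y * b) \<in> V \<Longrightarrow> b \<noteq> 0 \<Longrightarrow> mixed_deriv D D' y \<in> V"
proof -
  have \<tau>: "\<tau> \<in> V" "\<tau>' \<in> V"
    unfolding V_def by (auto intro: fun_space.span_base)
  have yb: "mixed_deriv D D' (y * b) =
      (\<lambda>p. y * mixed_deriv D D' b p) + (\<lambda>p. b * mixed_deriv D D' y p) + \<tau> + \<tau>'"
    by (simp add: mixed_deriv_mult \<tau>_def \<tau>'_def)
  show "mixed_deriv D D' (y * b) \<in> V" if "mixed_deriv D D' y \<in> V"
    using that b \<tau> unfolding yb V_def by (intro fun_space.span_add fun_space.span_scale)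
  show "mixed_deriv D D' y \<in> V" if "mixed_deriv D D' (y * b) \<in> V" "b \<noteq> 0"
  proof -
    have "(\<lambda>p. b * mixed_deriv D D' y p) =
        mixed_deriv D D' (y * b) - (\<lambda>p. y * mixed_deriv D D' b p) - \<tau> - \<tau>'"
      unfolding yb by (simp add: algebra_simps)
    also have "\<dots> \<in> V"
      using that b \<tau> unfolding V_def by (intro fun_space.span_diff fun_space.span_scale)
    finally have "(\<lambda>p. inverse b * (b * mixed_deriv D D' y p)) \<in> V"
      unfolding V_def by (rule fun_space.span_scale)
    then show ?thesis
      using that(2) by (simp flip: mult.assoc)
  qed
qed

text \<open>A product contributes two new rank-one matrices; reading \<open>a = (a / b) * b\<close> backwards gives the
  same for a quotient.\<close>

lemma mixed_deriv_operation_span: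
  assumes a: "mixed_deriv D D' a \<in> fun_space.span T" and b: "mixed_deriv D D' b \<in> fun_space.span T"
    and x: "x = a + b \<or> x = a - b \<or> x = a * b \<or> (b \<noteq> 0 \<and> x = a / b)"
  obtains \<tau> \<tau>' where "\<tau> \<in> rank_one" "\<tau>' \<in> rank_one"
    "mixed_deriv D D' x \<in> fun_space.span (insert \<tau> (insert \<tau>' T))"
proof -
  define y where "y = (if b \<noteq> 0 \<and> x = a / b then x else a)"
  define \<tau> where "\<tau> = outer_product (\<lambda>u. D u y) (\<lambda>v. D' v b)"
  define \<tau>' where "\<tau>' = outer_product (\<lambda>u. D u b) (\<lambda>v. D' v y)"
  let ?V = "fun_space.span (insert \<tau> (insert \<tau>' T))"
  have ab: "mixed_deriv D D' a \<in> ?V" "mixed_deriv D D' b \<in> ?V"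
    using a b fun_space.span_mono[of T "insert \<tau> (insert \<tau>' T)"] by auto
  note yb = mixed_deriv_mult_span[of b y, folded \<tau>_def \<tau>'_def, OF ab(2)]
  consider "x = a + b" | "x = a - b" | "x = a * b" "y = a" | "b \<noteq> 0" "x = y" "a = y * b"
    using x unfolding y_def by (cases "b \<noteq> 0 \<and> x = a / b") auto
  then have "mixed_deriv D D' x \<in> ?V"
  proof cases
    case 3
    then show ?thesis
      using yb(1) ab(1) by simp
  next
    case 4
    then show ?thesis
      using yb(2) ab(1) by simp
  qed (auto simp: mixed_deriv_add mixed_deriv_diff intro!: fun_space.span_add fun_space.span_diff ab)
  then show thesis
    by (rule that[rotated 2]) (auto simp: \<tau>_def \<tau>'_def rank_one_def)
qed

lemma straight_line_mixed_deriv_span: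
  assumes S: "\<And>x. x \<in> S \<Longrightarrow> mixed_deriv D D' x = 0" and "straight_line S gs"
  shows "\<exists>T. finite T \<and> card T \<le> 2 * length gs \<and> T \<subseteq> rank_one \<and>
    mixed_deriv D D' ` (S \<union> set gs) \<subseteq> fun_space.span T"
  using assms(2)
proof (induction rule: straight_line.induct)
  case empty
  show ?case
    by (rule exI[of _ "{}"]) (auto simp: S)
next
  case (step gs a b x)
  then obtain T where T: "finite T" "card T \<le> 2 * length gs" "T \<subseteq> rank_one"
    "mixed_deriv D D' ` (S \<union> set gs) \<subseteq> fun_space.span T"
    by blast
  with step.hyps(2,3) have "mixed_deriv D D' a \<in> fun_space.span T" "mixed_deriv D D' b \<in> fun_space.span T"
    by blast+
  then obtain \<tau> \<tau>' where \<tau>: "\<tau> \<in> rank_one" "\<tau>' \<in> rank_one"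
    "mixed_deriv D D' x \<in> fun_space.span (insert \<tau> (insert \<tau>' T))"
    using step.hyps(4) by (rule mixed_deriv_operation_span)
  have "card (insert \<tau> (insert \<tau>' T)) \<le> 2 * length (gs @ [x])"
    using T(1,2) by (simp add: card_insert_if)
  then show ?case
    using T \<tau> fun_space.span_mono[of T "insert \<tau> (insert \<tau>' T)"]
    by (intro exI[of _ "insert \<tau> (insert \<tau>' T)"]) auto
qed

end

lemma generic_product_index:
  assumes "i < p" "k < r"
  shows "(generic_left p q * generic_right q r) $$ (i, k)
    = (\<Sum>j<q. rf_var (2 * prod_encode (i, j)) * rf_var (2 * prod_encode (j, k) + 1))"
  using assms by (simp add: generic_left_def generic_right_def scalar_prod_def lessThan_atLeast0)

lemma rf_deriv_generic_product:
  assumes "i' < p" "k' < r" "j' < q"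
  shows "rf_deriv (2 * prod_encode (i, j)) (rf_deriv (2 * prod_encode (j', k) + 1)
      ((generic_left p q * generic_right q r :: 'f::field ratfun mat) $$ (i', k')))
    = matmul_tensor (i, j) (j', k) (i', k')"
proof -
  let ?u = "2 * prod_encode (i, j)" and ?v = "2 * prod_encode (j', k) + 1"
  let ?x = "\<lambda>t. rf_var (2 * prod_encode (i', t)) :: 'f ratfun"
  have parity: "2 * a \<noteq> Suc (2 * b)" for a b :: nat
    by presburger
  have "rf_deriv ?v (?x t * rf_var (2 * prod_encode (t, k') + 1))
      = of_bool (t = j') * (of_bool (k' = k) * ?x t)" for t
    unfolding derivation_mult[OF derivation_rf_deriv] by (auto simp: parity)
  then have "rf_deriv ?v ((generic_left p q * generic_right q r) $$ (i', k'))
      = (\<Sum>t<q. of_bool (t = j') * (of_bool (k' = k) * ?x t))"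
    by (simp only: generic_product_index[OF assms(1,2)] derivation_sum[OF derivation_rf_deriv])
  also have "\<dots> = of_bool (k' = k) * ?x j'"
    using assms(3) by (simp only: sum_of_bool_mult(1) finite_lessThan lessThan_iff)
  finally show ?thesis
    by (auto simp: derivation_rf_deriv)
qed

lemma slices_in_rank_one_span_imp_tensor_rank_le:
  fixes T :: "('u \<times> 'v \<Rightarrow> 'k::field) set"
  assumes fin: "finite T" and T: "T \<subseteq> rank_one"
    and slice: "\<And>c. c \<in> C \<Longrightarrow> m c \<in> fun_space.span T"
    and t: "\<And>a b c. a \<in> A \<Longrightarrow> b \<in> B \<Longrightarrow> c \<in> C \<Longrightarrow> t a b c = m c (\<alpha> a, \<beta> b)"
  shows "tensor_rank_le UNIV A B C t (card T)"
proof -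
  have "\<forall>\<tau>\<in>T. \<exists>f g. \<tau> = outer_product f g"
    using T by (auto simp: rank_one_def)
  then obtain f g where fg: "\<And>\<tau>. \<tau> \<in> T \<Longrightarrow> \<tau> = outer_product (f \<tau>) (g \<tau>)"
    by metis
  have "\<forall>c\<in>C. \<exists>h. m c = (\<Sum>\<tau>\<in>T. (\<lambda>x. h \<tau> * \<tau> x))"
    using slice unfolding fun_space.span_finite[OF fin] by blast
  from bchoice[OF this] obtain h where h: "\<And>c. c \<in> C \<Longrightarrow> m c = (\<Sum>\<tau>\<in>T. (\<lambda>x. h c \<tau> * \<tau> x))"
    by blast
  have "t a b c = (\<Sum>\<tau>\<in>T. f \<tau> (\<alpha> a) * g \<tau> (\<beta> b) * h c \<tau>)" if "a \<in> A" "b \<in> B" "c \<in> C" for a b c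
  proof -
    have "t a b c = (\<Sum>\<tau>\<in>T. h c \<tau> * \<tau> (\<alpha> a, \<beta> b))"
      by (simp add: t[OF that] h[OF that(3)] sum_fun_apply)
    also have "\<dots> = (\<Sum>\<tau>\<in>T. f \<tau> (\<alpha> a) * g \<tau> (\<beta> b) * h c \<tau>)"
    proof (rule sum.cong[OF refl])
      fix \<tau> assume "\<tau> \<in> T"
      from fun_cong[OF fg[OF this], of "(\<alpha> a, \<beta> b)"]
      show "h c \<tau> * \<tau> (\<alpha> a, \<beta> b) = f \<tau> (\<alpha> a) * g \<tau> (\<beta> b) * h c \<tau>"
        by (simp add: outer_product_def mult.commute)
    qed
    finally show ?thesis .
  qed
  then have "tensor_decomp UNIV A B C t T (\<lambda>\<tau> a. f \<tau> (\<alpha> a)) (\<lambda>\<tau> b. g \<tau> (\<beta> b)) (\<lambda>\<tau> c. h c \<tau>)"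
    unfolding tensor_decomp_def by blast
  then show ?thesis
    by (rule tensor_decomp_imp_rank_le[OF _ fin])
qed

lemma matmul_in_imp_ratfun_rank:
  assumes "matmul_in TYPE('f::field) p q r s"
  shows "matmul_rank_le (UNIV :: 'f ratfun set) p q r (2 * s)"
proof -
  let ?S = "range (rf_const :: 'f \<Rightarrow> 'f ratfun)
          \<union> elements_mat (generic_left p q) \<union> elements_mat (generic_right q r)"
  let ?P = "generic_left p q * generic_right q r :: 'f ratfun mat"
  let ?M = "mixed_deriv rf_deriv rf_deriv :: 'f ratfun \<Rightarrow> nat \<times> nat \<Rightarrow> 'f ratfun"
  obtain gs where gs: "straight_line ?S gs" "length gs \<le> s" "elements_mat ?P \<subseteq> ?S \<union> set gs"
    using assms unfolding matmul_in_def computable_in_def by blast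
  have "?M x = 0" if "x \<in> ?S" for x
  proof -
    from that consider c where "x = rf_const c" | w where "x = rf_var w"
      by (auto simp: generic_left_def generic_right_def dest!: elements_matD)
    then show ?thesis
      by cases (auto simp: mixed_deriv_def fun_eq_iff of_bool_def derivation_rf_deriv)
  qed
  from straight_line_mixed_deriv_span[OF derivation_rf_deriv derivation_rf_deriv this gs(1)]
  obtain T where T: "finite T" "card T \<le> 2 * length gs" "T \<subseteq> rank_one"
    "?M ` (?S \<union> set gs) \<subseteq> fun_space.span T"
    by blast
  have "matmul_rank_le (UNIV :: 'f ratfun set) p q r (card T)"
    unfolding matmul_rank_le_def
  proof (rule slices_in_rank_one_span_imp_tensor_rank_le[OF T(1,3)])
    fix z assume "z \<in> {..<p} \<times> {..<r}"
    then have "?P $$ z \<in> elements_mat ?P"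
      by (intro elements_matI[of _ p r "fst z" "snd z"]) (auto simp: generic_left_def generic_right_def)
    then show "?M (?P $$ z) \<in> fun_space.span T"
      using gs(3) T(4) by blast
  next
    fix a b z assume "a \<in> {..<p} \<times> {..<q}" "b \<in> {..<q} \<times> {..<r}" "z \<in> {..<p} \<times> {..<r}"
    then show "matmul_tensor a b z = ?M (?P $$ z) (2 * prod_encode a, 2 * prod_encode b + 1)"
      by (auto simp: mixed_deriv_def rf_deriv_generic_product[unfolded Suc_eq_plus1[symmetric]])
  qed
  then show ?thesis
    by (rule matmul_rank_le_mono) (use T(2) gs(2) in linarith)
qed

section \<open>Descent of tensor rank to the base field\<close>

definition monomial_values :: "'a::comm_monoid_mult set \<Rightarrow> nat \<Rightarrow> 'a set" where
  "monomial_values E t = (\<lambda>c. \<Prod>x\<in>E. x ^ c x) ` (E \<rightarrow>\<^sub>E {..t})"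

lemma finite_monomial_values: "finite E \<Longrightarrow> finite (monomial_values E t)"
  unfolding monomial_values_def by (intro finite_imageI finite_PiE) auto

lemma card_monomial_values_le:
  assumes "finite E"
  shows "card (monomial_values E t) \<le> (t + 1) ^ card E"
proof -
  have "card (monomial_values E t) \<le> card (E \<rightarrow>\<^sub>E {..t})"
    unfolding monomial_values_def using assms by (intro card_image_le finite_PiE) auto
  then show ?thesis
    using assms by (simp add: card_PiE)
qed

lemma prod_power_fun_upd_Suc:
  fixes z :: "'i \<Rightarrow> 'a::comm_monoid_mult"
  assumes "finite I" "i \<in> I"
  shows "(\<Prod>j\<in>I. z j ^ (c(i := Suc (c i))) j) = z i * (\<Prod>j\<in>I. z j ^ c j)"
proof -
  have "(\<Prod>j\<in>I - {i}. z j ^ (c(i := Suc (c i))) j) = (\<Prod>j\<in>I - {i}. z j ^ c j)"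
    by (rule prod.cong) auto
  then show ?thesis
    by (simp add: prod.remove[OF assms] mult.assoc)
qed

lemma mult_mem_monomial_values:
  assumes fin: "finite E" and x: "x \<in> E" and y: "y \<in> monomial_values E t"
  shows "x * y \<in> monomial_values E (Suc t)"
proof -
  obtain c where c: "c \<in> E \<rightarrow>\<^sub>E {..t}" "y = (\<Prod>z\<in>E. z ^ c z)"
    using y unfolding monomial_values_def by blast
  have "x * y = (\<Prod>z\<in>E. z ^ (c(x := Suc (c x))) z)"
    unfolding c(2) prod_power_fun_upd_Suc[OF fin x, of "\<lambda>z. z"] ..
  moreover have "c(x := Suc (c x)) \<in> E \<rightarrow>\<^sub>E {..Suc t}"
    using c(1) x by (auto simp: PiE_iff extensional_def le_Suc_eq)
  ultimately show ?thesis
    unfolding monomial_values_def by blast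
qed

lemma matmul_rank_le_power:
  assumes fin: "finite E" and rank: "matmul_rank_le E p q r R"
  shows "matmul_rank_le (monomial_values E t) (p ^ t) (q ^ t) (r ^ t) (R ^ t)"
proof (induction t)
  case 0
  have "(1::'a) \<in> monomial_values E 0"
    unfolding monomial_values_def by (rule image_eqI[of _ _ "\<lambda>x\<in>E. 0"]) auto
  then show ?case
    using matmul_rank_le_coeffs_mono[OF matmul_rank_le_1] by auto
next
  case (Suc t)
  show ?case
    unfolding power_Suc
    by (rule matmul_rank_le_mult[OF rank Suc.IH mult_mem_monomial_values[OF fin]])
qed

lemma rf_const_0 [simp]: "rf_const 0 = (0 :: 'f::field ratfun)"
  and rf_const_1 [simp]: "rf_const 1 = (1 :: 'f ratfun)"
  and rf_const_add: "rf_const (a + b) = rf_const a + (rf_const b :: 'f ratfun)"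
  and rf_const_mult: "rf_const (a * b) = rf_const a * (rf_const b :: 'f ratfun)"
  by (simp_all add: rf_const_def Zero_fract_def One_fract_def single_add mult_single)

lemma additive_retraction_exists:
  obtains \<phi> :: "'f::field ratfun \<Rightarrow> 'f" where "\<phi> 0 = 0" "\<phi> 1 = 1" "\<And>x y. \<phi> (x + y) = \<phi> x + \<phi> y"
proof -
  interpret vector_space_pair "\<lambda>(c::'f) (x::'f ratfun). rf_const c * x" "(*) :: 'f \<Rightarrow> 'f \<Rightarrow> 'f"
    by unfold_locales (simp_all add: rf_const_add rf_const_mult algebra_simps)
  have "vs1.independent {1}"
    by (simp add: vs1.dependent_single)
  from linear_independent_extend[OF this, of "\<lambda>_. 1"]
  obtain \<phi> where \<phi>: "Vector_Spaces.linear (\<lambda>(c::'f) (x::'f ratfun). rf_const c * x) (*) \<phi>" "\<phi> 1 = 1"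
    by auto
  then show thesis
    by (intro that[of \<phi>]) (auto simp: linear_add linear_0)
qed

lemma matmul_rank_le_ratfun_power_descend:
  assumes "matmul_rank_le (UNIV :: 'f::field ratfun set) p q r R"
  obtains e where "\<And>t. matmul_rank_le (UNIV :: 'f set) (p ^ t) (q ^ t) (r ^ t) (R ^ t * (t + 1) ^ e)"
proof -
  obtain E :: "'f ratfun set" where E: "finite E" "matmul_rank_le E p q r R"
    using assms unfolding matmul_rank_le_def by (rule tensor_rank_le_finite_coeffs) auto
  obtain \<phi> :: "'f ratfun \<Rightarrow> 'f" where \<phi>: "\<phi> 0 = 0" "\<phi> 1 = 1" "\<And>x y. \<phi> (x + y) = \<phi> x + \<phi> y"
    by (rule additive_retraction_exists) blast
  have "matmul_rank_le (UNIV :: 'f set) (p ^ t) (q ^ t) (r ^ t) (R ^ t * (t + 1) ^ (card E * 3))" for t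
  proof (rule matmul_rank_le_mono)
    show "matmul_rank_le (UNIV :: 'f set) (p ^ t) (q ^ t) (r ^ t) (R ^ t * card (monomial_values E t) ^ 3)"
      by (rule matmul_rank_le_additive_image[OF matmul_rank_le_power[OF E]
            finite_monomial_values[OF E(1)] \<phi>])
    show "R ^ t * card (monomial_values E t) ^ 3 \<le> R ^ t * (t + 1) ^ (card E * 3)"
      unfolding power_mult using E(1) by (intro mult_left_mono power_mono card_monomial_values_le) auto
  qed
  then show thesis by (rule that)
qed

section \<open>From tensor rank to straight-line programs\<close>

lemma straight_line_mono: "straight_line S gs \<Longrightarrow> S \<subseteq> S' \<Longrightarrow> straight_line S' gs"
proof (induction rule: straight_line.induct)
  case (step gs u v g)
  show ?case
    by (rule straight_line.step[OF _ _ _ step.hyps(4)]) (use step in auto)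
qed (rule straight_line.empty)

lemma straight_line_append:
  assumes "straight_line (S \<union> set gs) hs" "straight_line S gs"
  shows "straight_line S (gs @ hs)"
  using assms
proof (induction rule: straight_line.induct)
  case (step hs u v g)
  then have "straight_line S ((gs @ hs) @ [g])"
    by (intro straight_line.step[of S "gs @ hs" u v g]) (simp_all add: Un_assoc)
  then show ?case by simp
qed simp

lemma computable_in_mono:
  "computable_in S Y s \<Longrightarrow> S \<subseteq> S' \<Longrightarrow> Y' \<subseteq> Y \<Longrightarrow> s \<le> s' \<Longrightarrow> computable_in S' Y' s'"
  unfolding computable_in_def
  by (elim exE conjE, rule exI, intro conjI, erule (1) straight_line_mono) auto

lemma computable_in_trans:
  assumes "computable_in S Y s" "computable_in (S \<union> Y) Z s'"
  shows "computable_in S (Y \<union> Z) (s + s')"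
proof -
  obtain gs where gs: "straight_line S gs" "length gs \<le> s" "Y \<subseteq> S \<union> set gs"
    using assms(1) unfolding computable_in_def by blast
  obtain hs where hs: "straight_line (S \<union> Y) hs" "length hs \<le> s'" "Z \<subseteq> S \<union> Y \<union> set hs"
    using assms(2) unfolding computable_in_def by blast
  have "straight_line S (gs @ hs)"
    by (rule straight_line_append[OF straight_line_mono[OF hs(1)] gs(1)]) (use gs in auto)
  then show ?thesis
    unfolding computable_in_def by (intro exI[of _ "gs @ hs"]) (use gs hs in auto)
qed

lemma computable_in_Un:
  assumes "computable_in S Y s" "computable_in S Z s'"
  shows "computable_in S (Y \<union> Z) (s + s')"
  by (rule computable_in_trans[OF assms(1) computable_in_mono[OF assms(2)]]) auto

lemma computable_in_inputs: "Y \<subseteq> S \<Longrightarrow> computable_in S Y 0"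
  unfolding computable_in_def by (intro exI[of _ "[]"]) (auto intro: straight_line.empty)

lemma computable_in_UN:
  assumes "finite A" "\<And>a. a \<in> A \<Longrightarrow> computable_in S (Y a) s"
  shows "computable_in S (\<Union>a\<in>A. Y a) (card A * s)"
  using assms
proof (induction A rule: finite_induct)
  case empty
  then show ?case by (simp add: computable_in_inputs)
next
  case (insert a A)
  then show ?case using computable_in_Un[of S "Y a" s "\<Union>a\<in>A. Y a" "card A * s"] by simp
qed

lemma computable_in_add: "u \<in> S \<Longrightarrow> v \<in> S \<Longrightarrow> computable_in S {u + v} 1"
  and computable_in_mult: "u \<in> S \<Longrightarrow> v \<in> S \<Longrightarrow> computable_in S {u * v} 1"
proof -
  have "computable_in S {g} 1" if "u \<in> S" "v \<in> S" "g = u + v \<or> g = u * v" for g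
  proof -
    have "straight_line S ([] @ [g])"
      by (rule straight_line.step[OF straight_line.empty, of u _ v]) (use that in auto)
    then show ?thesis
      unfolding computable_in_def by force
  qed
  then show "u \<in> S \<Longrightarrow> v \<in> S \<Longrightarrow> computable_in S {u + v} 1" "u \<in> S \<Longrightarrow> v \<in> S \<Longrightarrow> computable_in S {u * v} 1"
    by simp_all
qed

lemma computable_in_sum_products:
  assumes "finite A" "0 \<in> S" "\<And>a. a \<in> A \<Longrightarrow> c a \<in> S" "\<And>a. a \<in> A \<Longrightarrow> x a \<in> S"
  shows "computable_in S {\<Sum>a\<in>A. c a * x a} (2 * card A)"
  using assms
proof (induction A rule: finite_induct)
  case empty
  then show ?case by (simp add: computable_in_inputs)
next
  case (insert a A)
  let ?y = "\<Sum>a\<in>A. c a * x a"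
  have summands: "computable_in S ({?y} \<union> {c a * x a}) (2 * card A + 1)"
    by (rule computable_in_Un[OF insert.IH computable_in_mult]) (use insert.prems in auto)
  have "computable_in (S \<union> ({?y} \<union> {c a * x a})) {c a * x a + ?y} 1"
    by (rule computable_in_add) auto
  from computable_in_trans[OF summands this] show ?case
    by (rule computable_in_mono) (use insert in auto)
qed

lemma elements_mat_eq_UN:
  assumes "A \<in> carrier_mat m n"
  shows "elements_mat A = (\<Union>ij\<in>{..<m} \<times> {..<n}. {A $$ ij})"
  using assms by (auto dest!: elements_matD)

lemma elements_mat_subset_iff:
  assumes "A \<in> carrier_mat m n"
  shows "elements_mat A \<subseteq> S \<longleftrightarrow> (\<forall>i<m. \<forall>j<n. A $$ (i, j) \<in> S)"
  unfolding elements_mat_eq_UN[OF assms] by auto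

lemma computable_in_elements_mat:
  assumes "A \<in> carrier_mat m n" "\<And>i j. i < m \<Longrightarrow> j < n \<Longrightarrow> computable_in S {A $$ (i, j)} s"
  shows "computable_in S (elements_mat A) (m * n * s)"
proof -
  have "computable_in S (elements_mat A) (card ({..<m} \<times> {..<n}) * s)"
    unfolding elements_mat_eq_UN[OF assms(1)]
    by (rule computable_in_UN) (auto intro: assms(2))
  then show ?thesis by simp
qed

lemma mult_mat_index:
  assumes "A \<in> carrier_mat m n" "B \<in> carrier_mat n l" "i < m" "k < l"
  shows "(A * B) $$ (i, k) = (\<Sum>j<n. A $$ (i, j) * B $$ (j, k))"
  using assms by (simp add: scalar_prod_def lessThan_atLeast0)

definition matmul_cost_le :: "'k::field set \<Rightarrow> nat \<Rightarrow> nat \<Rightarrow> nat \<Rightarrow> nat \<Rightarrow> bool" where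
  "matmul_cost_le C p q r s \<longleftrightarrow> (\<forall>S. \<forall>A\<in>carrier_mat p q. \<forall>B\<in>carrier_mat q r.
     C \<union> elements_mat A \<union> elements_mat B \<subseteq> S \<longrightarrow> computable_in S (elements_mat (A * B)) s)"

lemma matmul_cost_leI:
  assumes "\<And>S A B. A \<in> carrier_mat p q \<Longrightarrow> B \<in> carrier_mat q r \<Longrightarrow>
    C \<union> elements_mat A \<union> elements_mat B \<subseteq> S \<Longrightarrow> computable_in S (elements_mat (A * B)) s"
  shows "matmul_cost_le C p q r s"
  unfolding matmul_cost_le_def by (intro allI ballI impI assms)

lemma matmul_cost_leD:
  assumes "matmul_cost_le C p q r s" "A \<in> carrier_mat p q" "B \<in> carrier_mat q r"
    "C \<union> elements_mat A \<union> elements_mat B \<subseteq> S"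
  shows "computable_in S (elements_mat (A * B)) s"
  using assms unfolding matmul_cost_le_def by blast

lemma matmul_cost_le_naive:
  assumes "0 \<in> C"
  shows "matmul_cost_le C p q r (p * r * (2 * q))"
proof (rule matmul_cost_leI)
  fix S A B
  assume A: "A \<in> carrier_mat p q" and B: "B \<in> carrier_mat q r"
    and S: "C \<union> elements_mat A \<union> elements_mat B \<subseteq> S"
  show "computable_in S (elements_mat (A * B)) (p * r * (2 * q))"
  proof (rule computable_in_elements_mat)
    fix i k assume "i < p" "k < r"
    then have "computable_in S {\<Sum>j<q. A $$ (i, j) * B $$ (j, k)} (2 * card {..<q})"
      using S assms by (intro computable_in_sum_products)
        (auto simp: elements_mat_subset_iff[OF A] elements_mat_subset_iff[OF B])
    then show "computable_in S {(A * B) $$ (i, k)} (2 * q)"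
      by (simp only: mult_mat_index[OF A B \<open>i < p\<close> \<open>k < r\<close>] card_lessThan)
  qed (use A B in simp)
qed

lemma matmul_cost_le_mono:
  assumes "matmul_cost_le C p q r s" "s \<le> s'"
  shows "matmul_cost_le C p q r s'"
  by (rule matmul_cost_leI)
     (rule computable_in_mono[OF matmul_cost_leD[OF assms(1)] subset_refl subset_refl assms(2)])

lemma matmul_cost_le_antimono:
  assumes C: "0 \<in> C" and cost: "matmul_cost_le C p q r s" and le: "p' \<le> p" "q' \<le> q" "r' \<le> r"
  shows "matmul_cost_le C p' q' r' s"
proof (rule matmul_cost_leI)
  fix S A B
  assume A: "A \<in> carrier_mat p' q'" and B: "B \<in> carrier_mat q' r'"
    and S: "C \<union> elements_mat A \<union> elements_mat B \<subseteq> S"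
  define A' where "A' = mat p q (\<lambda>(i, j). if i < p' \<and> j < q' then A $$ (i, j) else 0)"
  define B' where "B' = mat q r (\<lambda>(j, k). if j < q' \<and> k < r' then B $$ (j, k) else 0)"
  have carrier: "A' \<in> carrier_mat p q" "B' \<in> carrier_mat q r"
    by (simp_all add: A'_def B'_def)
  have "C \<union> elements_mat A' \<union> elements_mat B' \<subseteq> S"
    using S C unfolding Un_subset_iff elements_mat_subset_iff[OF A] elements_mat_subset_iff[OF B]
      elements_mat_subset_iff[OF carrier(1)] elements_mat_subset_iff[OF carrier(2)]
    by (auto simp: A'_def B'_def)
  then have "computable_in S (elements_mat (A' * B')) s"
    by (rule matmul_cost_leD[OF cost carrier])
  moreover have "elements_mat (A * B) \<subseteq> elements_mat (A' * B')"
    unfolding elements_mat_subset_iff[OF mult_carrier_mat[OF A B]]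
  proof (intro allI impI)
    fix i k assume ik: "i < p'" "k < r'"
    have "(\<Sum>j<q. A' $$ (i, j) * B' $$ (j, k)) = (\<Sum>j<q'. A $$ (i, j) * B $$ (j, k))"
      by (rule sum.mono_neutral_cong_right) (use le ik in \<open>auto simp: A'_def B'_def\<close>)
    then have "(A * B) $$ (i, k) = (A' * B') $$ (i, k)"
      using ik le by (simp add: mult_mat_index[OF A B] mult_mat_index[OF carrier] del: index_mult_mat)
    then show "(A * B) $$ (i, k) \<in> elements_mat (A' * B')"
      using ik le by (intro elements_matI[OF mult_carrier_mat[OF carrier], of i k]) auto
  qed
  ultimately show "computable_in S (elements_mat (A * B)) s"
    by (rule computable_in_mono[OF _ subset_refl _ order_refl])
qed

lemma sum_blocks: "(\<Sum>j<Q * q. F j) = (\<Sum>b<Q. \<Sum>j<q. F (b * q + j :: nat))"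
proof -
  have "(\<Sum>j\<in>{b * q..<b * q + q}. F j) = (\<Sum>j<q. F (b * q + j))" for b
    using sum.shift_bounds_nat_ivl[of F 0 "b * q" q] by (simp add: lessThan_atLeast0 add.commute)
  then show ?thesis
    unfolding sum.nat_group[symmetric] by simp
qed

lemma block_index_less:
  fixes x y z n :: nat
  assumes "x < n" "z < y"
  shows "x * y + z < n * y"
proof -
  have "x * y + z < (x + 1) * y" using assms by simp
  also have "\<dots> \<le> n * y" using assms by (intro mult_right_mono) auto
  finally show ?thesis .
qed

definition block_combination ::
    "nat \<Rightarrow> nat \<Rightarrow> nat \<Rightarrow> nat \<Rightarrow> (nat \<times> nat \<Rightarrow> 'k) \<Rightarrow> 'k mat \<Rightarrow> 'k::semiring_0 mat" where
  "block_combination P Q p q w A =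
     mat p q (\<lambda>(i, j). \<Sum>z\<in>{..<P} \<times> {..<Q}. w z * A $$ (fst z * p + i, snd z * q + j))"

lemma block_combination_carrier [simp]: "block_combination P Q p q w A \<in> carrier_mat p q"
  by (simp add: block_combination_def)

lemma computable_in_block_combination:
  assumes A: "A \<in> carrier_mat (P * p) (Q * q)" and S: "elements_mat A \<subseteq> S" "0 \<in> S"
    and w: "w \<in> {..<P} \<times> {..<Q} \<rightarrow> S"
  shows "computable_in S (elements_mat (block_combination P Q p q w A)) (p * q * (2 * (P * Q)))"
proof (rule computable_in_elements_mat)
  fix i j assume ij: "i < p" "j < q"
  have "A $$ (fst z * p + i, snd z * q + j) \<in> S" if "z \<in> {..<P} \<times> {..<Q}" for z
    using S(1) that ij
    by (intro subsetD[OF S(1)] elements_matI[OF A]) (auto intro: block_index_less)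
  then have "computable_in S {\<Sum>z\<in>{..<P} \<times> {..<Q}. w z * A $$ (fst z * p + i, snd z * q + j)}
      (2 * card ({..<P} \<times> {..<Q}))"
    using S(2) w by (intro computable_in_sum_products) auto
  then show "computable_in S {block_combination P Q p q w A $$ (i, j)} (2 * (P * Q))"
    using ij by (simp add: block_combination_def)
qed simp

lemma block_product_index:
  assumes D: "tensor_decomp E ({..<P} \<times> {..<Q}) ({..<Q} \<times> {..<R}) ({..<P} \<times> {..<R}) matmul_tensor \<Lambda> f g h"
    and A: "A \<in> carrier_mat (P * p) (Q * q)" and B: "B \<in> carrier_mat (Q * q) (R * r)"
    and i: "i < P * p" and k: "k < R * r"
  shows "(A * B) $$ (i, k) = (\<Sum>l\<in>\<Lambda>. h l (i div p, k div r) *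
    (block_combination P Q p q (f l) A * block_combination Q R q r (g l) B) $$ (i mod p, k mod r))"
proof -
  have pos: "p > 0" "r > 0"
    using i k by (auto intro: gr0I)
  have div: "i div p < P" "k div r < R"
    using i k by (simp_all add: less_mult_imp_div_less)
  let ?x = "\<lambda>j z. A $$ (fst z * p + i mod p, snd z * q + j)"
  let ?y = "\<lambda>j z. B $$ (fst z * q + j, snd z * r + k mod r)"
  have "(block_combination P Q p q (f l) A * block_combination Q R q r (g l) B) $$ (i mod p, k mod r)
      = (\<Sum>j<q. (\<Sum>z\<in>{..<P} \<times> {..<Q}. f l z * ?x j z) * (\<Sum>z\<in>{..<Q} \<times> {..<R}. g l z * ?y j z))" for l
    using pos by (subst mult_mat_index[of _ p q _ r]) (simp_all add: block_combination_def)
  then have "(\<Sum>l\<in>\<Lambda>. h l (i div p, k div r) *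
      (block_combination P Q p q (f l) A * block_combination Q R q r (g l) B) $$ (i mod p, k mod r))
    = (\<Sum>j<q. \<Sum>l\<in>\<Lambda>. h l (i div p, k div r) *
        ((\<Sum>z\<in>{..<P} \<times> {..<Q}. f l z * ?x j z) * (\<Sum>z\<in>{..<Q} \<times> {..<R}. g l z * ?y j z)))"
    by (simp only: sum_distrib_left) (rule sum.swap)
  also have "\<dots> = (\<Sum>j<q. \<Sum>b<Q. ?x j (i div p, b) * ?y j (b, k div r))"
    using div by (intro sum.cong refl)
      (simp only: tensor_decomp_apply[OF D] sum_matmul_tensor mem_Sigma_iff lessThan_iff simp_thms)
  also have "\<dots> = (\<Sum>b<Q. \<Sum>j<q. A $$ (i, b * q + j) * B $$ (b * q + j, k))"
    by (subst sum.swap) simp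
  also have "\<dots> = (A * B) $$ (i, k)"
    by (simp only: mult_mat_index[OF A B i k] sum_blocks)
  finally show ?thesis ..
qed

lemma matmul_cost_le_step:
  fixes C :: "'k::field set"
  assumes rank: "matmul_rank_le C P Q R \<rho>" and zero: "0 \<in> C" and cost: "matmul_cost_le C p q r s"
  shows "matmul_cost_le C (P * p) (Q * q) (R * r)
    (\<rho> * s + 2 * \<rho> * (P * p * (Q * q) + Q * q * (R * r) + P * p * (R * r)))"
proof (rule matmul_cost_leI)
  fix S A B
  assume A: "A \<in> carrier_mat (P * p) (Q * q)" and B: "B \<in> carrier_mat (Q * q) (R * r)"
    and S: "C \<union> elements_mat A \<union> elements_mat B \<subseteq> S"
  from rank obtain f g h where
    D: "tensor_decomp C ({..<P} \<times> {..<Q}) ({..<Q} \<times> {..<R}) ({..<P} \<times> {..<R}) matmul_tensor {..<\<rho>} f g h"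
    unfolding matmul_rank_le_def by (rule tensor_rank_leE)
  then have coeffs: "f l \<in> {..<P} \<times> {..<Q} \<rightarrow> S" "g l \<in> {..<Q} \<times> {..<R} \<rightarrow> S" "h l \<in> {..<P} \<times> {..<R} \<rightarrow> S"
    if "l < \<rho>" for l
    using S that by (auto simp: tensor_decomp_def Pi_iff)
  let ?F = "\<lambda>l. block_combination P Q p q (f l) A" and ?G = "\<lambda>l. block_combination Q R q r (g l) B"
  define Y where "Y = (\<Union>l<\<rho>. elements_mat (?F l) \<union> elements_mat (?G l))"
  define Z where "Z = (\<Union>l<\<rho>. elements_mat (?F l * ?G l))"
  have "computable_in S Y (card {..<\<rho>} * (p * q * (2 * (P * Q)) + q * r * (2 * (Q * R))))"
    unfolding Y_def using A B S zero coeffs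
    by (intro computable_in_UN computable_in_Un computable_in_block_combination) auto
  moreover have "computable_in (S \<union> Y) Z (card {..<\<rho>} * s)"
    unfolding Z_def using S
    by (intro computable_in_UN matmul_cost_leD[OF cost]) (auto simp: Y_def)
  ultimately have YZ: "computable_in S (Y \<union> Z)
      (card {..<\<rho>} * (p * q * (2 * (P * Q)) + q * r * (2 * (Q * R))) + card {..<\<rho>} * s)"
    by (rule computable_in_trans)
  have "computable_in (S \<union> (Y \<union> Z)) (elements_mat (A * B)) (P * p * (R * r) * (2 * card {..<\<rho>}))"
  proof (rule computable_in_elements_mat)
    fix i k assume ik: "i < P * p" "k < R * r"
    then have pos: "p > 0" "r > 0"
      by (auto intro: gr0I)
    have "(?F l * ?G l) $$ (i mod p, k mod r) \<in> Z" if "l < \<rho>" for l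
      unfolding Z_def using pos that
      by (intro UN_I[of l] elements_matI[OF mult_carrier_mat[of _ p q _ r]]) auto
    then show "computable_in (S \<union> (Y \<union> Z)) {(A * B) $$ (i, k)} (2 * card {..<\<rho>})"
      unfolding block_product_index[OF D A B ik] using ik coeffs(3) S zero
      by (intro computable_in_sum_products) (auto simp: less_mult_imp_div_less Pi_iff)
  qed (use A B in simp)
  from computable_in_trans[OF YZ this]
  show "computable_in S (elements_mat (A * B))
     (\<rho> * s + 2 * \<rho> * (P * p * (Q * q) + Q * q * (R * r) + P * p * (R * r)))"
    by (rule computable_in_mono) (auto simp: algebra_simps)
qed

lemma matmul_cost_le_power:
  fixes C :: "'k::field set"
  assumes rank: "matmul_rank_le C P Q R \<rho>" and zero: "0 \<in> C" and pos: "P > 0" "Q > 0" "R > 0"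
  shows "matmul_cost_le C (P ^ t) (Q ^ t) (R ^ t) ((2 + 6 * \<rho> * t) * \<rho> ^ t)"
proof (induction t)
  case 0
  show ?case
    using matmul_cost_le_naive[OF zero, of 1 1 1] by simp
next
  case (Suc t)
  let ?s = "(2 + 6 * \<rho> * t) * \<rho> ^ t"
  have area: "X ^ Suc t * Y ^ Suc t \<le> \<rho> ^ Suc t" if "X * Y \<le> \<rho>" for X Y
    unfolding power_mult_distrib[symmetric] by (rule power_mono[OF that]) simp
  note areas = matmul_rank_ge[OF rank pos, THEN area]
  have cost: "matmul_cost_le C (P ^ Suc t) (Q ^ Suc t) (R ^ Suc t) (\<rho> * ?s + 2 * \<rho> *
      (P ^ Suc t * Q ^ Suc t + Q ^ Suc t * R ^ Suc t + P ^ Suc t * R ^ Suc t))"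
    using matmul_cost_le_step[OF rank zero Suc.IH] by (simp only: power_Suc)
  have "\<rho> * ?s + 2 * \<rho> * (P ^ Suc t * Q ^ Suc t + Q ^ Suc t * R ^ Suc t + P ^ Suc t * R ^ Suc t)
      \<le> \<rho> * ?s + 2 * \<rho> * (\<rho> ^ Suc t + \<rho> ^ Suc t + \<rho> ^ Suc t)"
    by (intro add_left_mono mult_left_mono add_mono areas) simp
  also have "\<dots> = (2 + 6 * \<rho> * Suc t) * \<rho> ^ Suc t"
    by (simp add: algebra_simps)
  finally show ?case
    by (rule matmul_cost_le_mono[OF cost])
qed

lemma matmul_cost_le_imp_matmul_in:
  assumes "matmul_cost_le (range (rf_const :: 'f::field \<Rightarrow> 'f ratfun)) p q r s"
  shows "matmul_in TYPE('f) p q r s"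
  unfolding matmul_in_def
  by (rule matmul_cost_leD[OF assms]) (auto simp: generic_left_def generic_right_def)

section \<open>Exponents of rectangular matrix multiplication\<close>

definition omega_exponents :: "'f::field itself \<Rightarrow> real \<Rightarrow> real \<Rightarrow> real \<Rightarrow> real set" where
  "omega_exponents F a b c = {w. w > 0 \<and>
     (\<exists>s :: nat \<Rightarrow> nat. (\<lambda>n. real (s n)) \<in> O(\<lambda>n. real n powr w) \<and>
        (\<forall>n. matmul_in F (dim_pow n a) (dim_pow n b) (dim_pow n c) (s n)))}"

lemma omega_exponentsI:
  assumes "w > 0" "(\<lambda>n. real (s n)) \<in> O(\<lambda>n. real n powr w)"
    and "\<And>n. matmul_in F (dim_pow n a) (dim_pow n b) (dim_pow n c) (s n)"
  shows "w \<in> omega_exponents F a b c"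
  unfolding omega_exponents_def using assms by blast

lemma omega_rect_eq_Inf: "omega_rect F a b c = Inf (omega_exponents F a b c)"
  unfolding omega_rect_def omega_exponents_def by simp

lemma omega_rect_le: "w \<in> omega_exponents F a b c \<Longrightarrow> omega_rect F a b c \<le> w"
  unfolding omega_rect_eq_Inf
  by (rule cInf_lower) (auto intro!: bdd_belowI[of _ 0] simp: omega_exponents_def)

lemma dim_pow_1 [simp]: "dim_pow n 1 = n"
  by (simp add: dim_pow_def)

lemma of_nat_dim_pow_le: "real (dim_pow n a) \<le> real n powr a"
  by (simp add: dim_pow_def)

lemma dim_pow_le:
  assumes "a \<le> 1"
  shows "dim_pow n a \<le> n"
proof (cases "n = 0")
  case False
  then have "real n powr a \<le> real n powr 1"
    using assms by (intro powr_mono) auto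
  then have "real (dim_pow n a) \<le> real n"
    using of_nat_dim_pow_le[of n a] by simp
  then show ?thesis by simp
qed (simp add: dim_pow_def)

lemma dim_pow_power:
  assumes "real p = real n powr a" "n > 0"
  shows "dim_pow (n ^ c) a = p ^ c"
proof -
  have "real (n ^ c) powr a = real (p ^ c)"
    using assms by (simp add: powr_realpow[symmetric] powr_powr mult.commute)
  then show ?thesis
    unfolding dim_pow_def by (metis floor_of_nat nat_int)
qed

lemma dim_pow_ge_powr_scaled:
  assumes "a \<ge> 0"
  obtains \<kappa> where "0 < \<kappa>" "\<And>n x. n \<ge> 1 \<Longrightarrow> 0 \<le> x \<Longrightarrow> x \<le> \<kappa> * real n \<Longrightarrow> x powr a \<le> real (dim_pow n a)"
proof (cases "a = 0")
  case True
  then show thesis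
    by (intro that[of 1]) (auto simp: dim_pow_def powr_def)
next
  case False
  define \<kappa> :: real where "\<kappa> = (1 / 2) powr (1 / a)"
  have "x powr a \<le> real (dim_pow n a)" if "n \<ge> 1" "0 \<le> x" "x \<le> \<kappa> * real n" for n x
  proof -
    have "x powr a \<le> (\<kappa> * real n) powr a"
      using that assms by (intro powr_mono2) auto
    also have "\<dots> = real n powr a / 2"
      using False by (simp add: \<kappa>_def powr_mult powr_powr)
    also have "\<dots> \<le> real (dim_pow n a)"
    proof -
      have "1 \<le> \<lfloor>real n powr a\<rfloor>"
        using that assms by (simp add: ge_one_powr_ge_zero)
      then have "1 \<le> real_of_int \<lfloor>real n powr a\<rfloor>" "real (dim_pow n a) = real_of_int \<lfloor>real n powr a\<rfloor>"
        by (simp_all add: dim_pow_def)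
      then show ?thesis by linarith
    qed
    finally show ?thesis .
  qed
  moreover have "\<kappa> > 0"
    by (simp add: \<kappa>_def)
  ultimately show thesis
    using that by blast
qed

lemma omega_exponents_nonempty:
  assumes "a \<le> 1" "b \<le> 1" "c \<le> 1"
  shows "omega_exponents TYPE('f::field) a b c \<noteq> {}"
proof -
  let ?s = "\<lambda>n. dim_pow n a * dim_pow n c * (2 * dim_pow n b)"
  have "matmul_in TYPE('f) (dim_pow n a) (dim_pow n b) (dim_pow n c) (?s n)" for n
    by (intro matmul_cost_le_imp_matmul_in matmul_cost_le_naive) (metis rangeI rf_const_0)
  moreover have "(\<lambda>n. real (?s n)) \<in> O(\<lambda>n. real n powr 3)"
  proof (intro bigoI[where c = 2] always_eventually allI)
    fix n
    have "?s n \<le> n * n * (2 * n)"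
      using assms by (intro mult_mono dim_pow_le) auto
    then have "real (?s n) \<le> real (n * n * (2 * n))"
      by (rule of_nat_mono)
    then show "norm (real (?s n)) \<le> 2 * norm (real n powr 3)"
      by (cases "n = 0") (simp_all add: powr_numeral power3_eq_cube)
  qed
  ultimately have "3 \<in> omega_exponents TYPE('f) a b c"
    by (intro omega_exponentsI) auto
  then show ?thesis by blast
qed

lemma le_omega_rect:
  assumes "a \<le> 1" "b \<le> 1" "c \<le> 1"
    and "\<And>w. w \<in> omega_exponents TYPE('f::field) a b c \<Longrightarrow> x \<le> w"
  shows "x \<le> omega_rect TYPE('f) a b c"
  unfolding omega_rect_eq_Inf using omega_exponents_nonempty[OF assms(1-3)] assms(4)
  by (rule cInf_greatest)

lemma omega_rect_approx:
  assumes "a \<le> 1" "b \<le> 1" "c \<le> 1" "\<epsilon> > 0"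
  shows "\<exists>w\<in>omega_exponents TYPE('f::field) a b c. w < omega_rect TYPE('f) a b c + \<epsilon>"
  unfolding omega_rect_eq_Inf
  by (rule cInf_lessD) (use omega_exponents_nonempty[OF assms(1-3)] assms(4) in auto)

lemma omega_exponent_imp_ratfun_rank:
  assumes "w \<in> omega_exponents TYPE('f::field) a b c"
  obtains C where "C > 0" "\<And>n. n \<ge> 1 \<Longrightarrow> matmul_rank_le (UNIV :: 'f ratfun set)
    (dim_pow n a) (dim_pow n b) (dim_pow n c) (nat \<lfloor>C * real n powr w\<rfloor>)"
proof -
  from assms obtain s where s: "(\<lambda>n. real (s n)) \<in> O(\<lambda>n. real n powr w)"
    "\<And>n. matmul_in TYPE('f) (dim_pow n a) (dim_pow n b) (dim_pow n c) (s n)"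
    unfolding omega_exponents_def by blast
  from landau_o.bigE[OF s(1)] obtain C where C: "C > 0"
    "eventually (\<lambda>n. norm (real (s n)) \<le> C * norm (real n powr w)) at_top"
    by metis
  have "Bseq (\<lambda>n. real (s n) / real n powr w)"
    by (rule BfunI[where K = C], rule eventually_mono[OF C(2)]) (use C(1) in \<open>auto simp: divide_simps\<close>)
  then obtain K where K: "K > 0" "\<And>n. real (s n) / real n powr w \<le> K"
    by (auto elim!: BseqE)
  have "matmul_rank_le (UNIV :: 'f ratfun set) (dim_pow n a) (dim_pow n b) (dim_pow n c)
      (nat \<lfloor>2 * K * real n powr w\<rfloor>)" if "n \<ge> 1" for n
  proof (rule matmul_rank_le_mono[OF matmul_in_imp_ratfun_rank[OF s(2)]])
    have "real (2 * s n) \<le> 2 * K * real n powr w"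
      using K(2)[of n] that by (simp add: divide_simps split: if_splits)
    then show "2 * s n \<le> nat \<lfloor>2 * K * real n powr w\<rfloor>"
      by linarith
  qed
  with K(1) show thesis
    by (intro that[of "2 * K"]) auto
qed

lemma omega_exponent_imp_ratfun_rank_power:
  assumes w: "w \<in> omega_exponents TYPE('f::field) a 1 b" and n: "n > 0"
    and p: "real p = real n powr a" and s: "real s = real n powr b"
  obtains C where "C > 0" "\<And>m. matmul_rank_le (UNIV :: 'f ratfun set)
    (p ^ m) (n ^ m) (s ^ m) (nat \<lfloor>C * (real n powr w) ^ m\<rfloor>)"
proof -
  from w obtain C where C: "C > 0" "\<And>N. N \<ge> 1 \<Longrightarrow> matmul_rank_le (UNIV :: 'f ratfun set)
      (dim_pow N a) (dim_pow N 1) (dim_pow N b) (nat \<lfloor>C * real N powr w\<rfloor>)"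
    by (rule omega_exponent_imp_ratfun_rank) blast
  have "matmul_rank_le (UNIV :: 'f ratfun set)
      (p ^ m) (n ^ m) (s ^ m) (nat \<lfloor>C * (real n powr w) ^ m\<rfloor>)" for m
  proof -
    have "real (n ^ m) powr w = (real n powr w) ^ m"
      using n by (simp add: powr_powr mult.commute flip: powr_realpow)
    then show ?thesis
      using C(2)[of "n ^ m"] n unfolding dim_pow_power[OF p n] dim_pow_power[OF s n] dim_pow_1 by simp
  qed
  with C(1) show thesis by (rule that)
qed

lemma recursion_cost_bigo:
  assumes X: "(X::real) > 1" and \<rho>: "\<rho> \<ge> 1" and w: "w > log X (real \<rho>)"
  shows "(\<lambda>n. real ((2 + 6 * \<rho> * nat \<lceil>log X (real n)\<rceil>) * \<rho> ^ nat \<lceil>log X (real n)\<rceil>)) \<in> O(\<lambda>n. real n powr w)"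
proof -
  define r where "r = real \<rho>"
  define v where "v = log X r"
  let ?t = "\<lambda>n. nat \<lceil>log X (real n)\<rceil>"
  let ?B = "\<lambda>n. (2 + 6 * r * (ln (real n) / ln X + 1)) * (r * real n powr v)"
  have r: "r \<ge> 1" using \<rho> by (simp add: r_def)
  have "real ((2 + 6 * \<rho> * ?t n) * \<rho> ^ ?t n) \<le> ?B n" if n: "n \<ge> 1" for n
  proof -
    have "log X (real n) \<ge> 0"
      using X n by simp
    then have t: "real (?t n) \<le> log X (real n) + 1"
      by linarith
    have "r ^ ?t n = r powr real (?t n)"
      using r by (simp add: powr_realpow)
    also have "\<dots> \<le> r powr (log X (real n) + 1)"
      using r t by (intro powr_mono) auto
    also have "\<dots> = r * (X powr v) powr log X (real n)"
      using r X by (simp add: powr_add v_def)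
    also have "\<dots> = r * real n powr v"
      using X n by (simp add: powr_powr mult.commute[of v] flip: powr_powr[of X "log X (real n)" v])
    finally have "r ^ ?t n \<le> r * real n powr v" .
    moreover have "2 + 6 * r * real (?t n) \<le> 2 + 6 * r * (ln (real n) / ln X + 1)"
      using t r by (intro add_left_mono mult_left_mono) (auto simp: log_def)
    moreover have "real ((2 + 6 * \<rho> * ?t n) * \<rho> ^ ?t n) = (2 + 6 * r * real (?t n)) * r ^ ?t n"
      by (simp add: r_def algebra_simps)
    ultimately show ?thesis
      using r X n by (simp only:, intro mult_mono)
        (auto intro!: add_nonneg_nonneg mult_nonneg_nonneg divide_nonneg_pos)
  qed
  then have "(\<lambda>n. real ((2 + 6 * \<rho> * ?t n) * \<rho> ^ ?t n)) \<in> O(?B)"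
    by (intro bigoI[where c = 1] eventually_sequentiallyI[of 1]) (use abs_ge_self order_trans in fastforce)
  also have "?B \<in> O(\<lambda>n. real n powr w)"
  proof -
    have "v < w" "X > 1" "r > 0" using w X r by (simp_all add: v_def r_def)
    then show ?thesis by real_asymp
  qed
  finally show ?thesis .
qed

lemma powr_power_le:
  assumes "(X::real) > 0" "X powr a \<le> real P"
  shows "(X ^ t) powr a \<le> real P ^ t"
proof -
  have "(X ^ t) powr a = (X powr a) ^ t"
    using assms(1) by (simp add: powr_powr mult.commute flip: powr_realpow)
  also have "\<dots> \<le> real P ^ t"
    by (rule power_mono[OF assms(2)]) simp
  finally show ?thesis .
qed

lemma dim_pow_le_power_ceiling_log:
  assumes X: "X > 1" and "0 \<le> a" "X powr a \<le> real P"
  shows "dim_pow n a \<le> P ^ nat \<lceil>log X (real n)\<rceil>"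
proof (cases "n = 0")
  case False
  let ?t = "nat \<lceil>log X (real n)\<rceil>"
  have "real n = X powr log X (real n)"
    using X False by simp
  also have "\<dots> \<le> X powr real ?t"
    using X by (intro powr_mono real_nat_ceiling_ge) simp
  finally have "real n powr a \<le> (X ^ ?t) powr a"
    using assms by (intro powr_mono2) (auto simp: powr_realpow)
  also have "\<dots> \<le> real P ^ ?t"
    using assms by (intro powr_power_le) auto
  finally show ?thesis
    using of_nat_dim_pow_le[of n a] by (metis of_nat_le_iff of_nat_power order_trans)
qed (simp add: dim_pow_def)

lemma omega_rect_le_log_rank:
  assumes X: "X > 1" and rank: "matmul_rank_le (UNIV :: 'f::field set) P Q R \<rho>"
    and abc: "0 \<le> a" "0 \<le> b" "0 \<le> c"
    and dims: "X powr a \<le> real P" "X powr b \<le> real Q" "X powr c \<le> real R"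
  shows "omega_rect TYPE('f) a b c \<le> log X (real \<rho>)"
proof (rule dense_ge)
  fix w assume w: "log X (real \<rho>) < w"
  let ?C = "range (rf_const :: 'f \<Rightarrow> 'f ratfun)"
  have pos: "P > 0" "Q > 0" "R > 0"
    using dims X by (auto intro!: gr0I)
  have "1 \<le> P * Q"
    using pos by (simp add: Suc_le_eq)
  also have "\<dots> \<le> \<rho>"
    by (rule matmul_rank_ge(1)[OF rank pos])
  finally have \<rho>: "\<rho> \<ge> 1" .
  have zero: "0 \<in> ?C"
    by (metis rangeI rf_const_0)
  have rank_scalars: "matmul_rank_le ?C P Q R \<rho>"
    by (rule matmul_rank_le_hom[OF rank]) (simp_all add: rf_const_add rf_const_mult)
  have "w > 0"
    using w X \<rho> by (smt (verit) zero_le_log_cancel_iff of_nat_1 of_nat_mono)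
  then have "w \<in> omega_exponents TYPE('f) a b c"
    using recursion_cost_bigo[OF X \<rho> w]
  proof (rule omega_exponentsI)
    fix n
    show "matmul_in TYPE('f) (dim_pow n a) (dim_pow n b) (dim_pow n c)
        ((2 + 6 * \<rho> * nat \<lceil>log X (real n)\<rceil>) * \<rho> ^ nat \<lceil>log X (real n)\<rceil>)"
      by (intro matmul_cost_le_imp_matmul_in dim_pow_le_power_ceiling_log X abc dims
          matmul_cost_le_antimono[OF zero matmul_cost_le_power[OF rank_scalars zero pos]])
  qed
  then show "omega_rect TYPE('f) a b c \<le> w"
    by (rule omega_rect_le)
qed

lemma omega_rect_le_log_ratfun_rank:
  assumes X: "X > 1" and rank: "matmul_rank_le (UNIV :: 'f::field ratfun set) P Q R (nat \<lfloor>B\<rfloor>)"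
    and abc: "0 \<le> a" "0 \<le> b" "0 \<le> c"
    and dims: "X powr a \<le> real P" "X powr b \<le> real Q" "X powr c \<le> real R"
  shows "omega_rect TYPE('f) a b c \<le> log X B"
proof -
  define \<rho> where "\<rho> = nat \<lfloor>B\<rfloor>"
  obtain e where
    descend: "\<And>t. matmul_rank_le (UNIV :: 'f set) (P ^ t) (Q ^ t) (R ^ t) (\<rho> ^ t * (t + 1) ^ e)"
    using matmul_rank_le_ratfun_power_descend[OF rank] unfolding \<rho>_def by blast
  have "P > 0" "Q > 0" "R > 0"
    using dims X by (auto intro!: gr0I)
  with matmul_rank_ge(1)[OF rank] have \<rho>: "\<rho> > 0"
    unfolding \<rho>_def by (metis mult_pos_pos less_le_trans)
  have bound: "omega_rect TYPE('f) a b c \<le> log X (real \<rho>) + real e * ln (real t + 1) / ln X / real t"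
    if t: "t \<ge> 1" for t
  proof -
    have "omega_rect TYPE('f) a b c \<le> log (X ^ t) (real (\<rho> ^ t * (t + 1) ^ e))"
      by (rule omega_rect_le_log_rank[OF _ descend abc]) (use X t dims in \<open>auto intro: powr_power_le\<close>)
    also have "\<dots> = log X (real \<rho>) + real e * ln (real t + 1) / ln X / real t"
      unfolding log_def using X t \<rho> by (simp add: ln_mult ln_realpow add_divide_distrib add.commute)
    finally show ?thesis .
  qed
  have "(\<lambda>t. v + real e * ln (real t + 1) / ln X / real t) \<longlonglongrightarrow> v" for v
    using X by real_asymp
  then have "omega_rect TYPE('f) a b c \<le> log X (real \<rho>)"
    by (rule LIMSEQ_le_const) (use bound in blast)
  also have "\<dots> \<le> log X B"
    using X \<rho> by (intro log_mono) (auto simp: \<rho>_def)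
  finally show ?thesis .
qed

lemma omega_rect_le_log_asymptotic_ratfun_rank:
  assumes X: "X > 1" and y: "y > 0" and C: "C > 0"
    and rank: "\<And>m. matmul_rank_le (UNIV :: 'f::field ratfun set) (P ^ m) (Q ^ m) (R ^ m) (nat \<lfloor>C * y ^ m\<rfloor>)"
    and abc: "0 \<le> a" "0 \<le> b" "0 \<le> c"
    and dims: "X powr a \<le> real P" "X powr b \<le> real Q" "X powr c \<le> real R"
  shows "omega_rect TYPE('f) a b c \<le> log X y"
proof -
  have bound: "omega_rect TYPE('f) a b c \<le> log X y + ln C / ln X / real m" if m: "m \<ge> 1" for m
  proof -
    have "omega_rect TYPE('f) a b c \<le> log (X ^ m) (C * y ^ m)"
      by (rule omega_rect_le_log_ratfun_rank[OF _ rank abc])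
         (use X m dims in \<open>auto intro: powr_power_le\<close>)
    also have "\<dots> = log X y + ln C / ln X / real m"
      unfolding log_def using X m C y by (simp add: ln_mult ln_realpow add_divide_distrib add.commute)
    finally show ?thesis .
  qed
  have "(\<lambda>m. v + ln C / ln X / real m) \<longlonglongrightarrow> v" for v
    by real_asymp
  then show ?thesis
    by (rule LIMSEQ_le_const) (use bound in blast)
qed

text \<open>The base \<open>\<kappa> n\<close> with a small constant \<open>\<kappa>\<close> absorbs the rounding of the dimensions.\<close>

lemma omega_rect_le_if_ratfun_rank_bound:
  assumes abc: "0 \<le> a" "0 \<le> b" "0 \<le> c" and C: "C > 0"
    and rank: "\<And>n. n \<ge> 1 \<Longrightarrow> matmul_rank_le (UNIV :: 'f::field ratfun set)
      (dim_pow n a) (dim_pow n b) (dim_pow n c) (nat \<lfloor>C * real n powr w\<rfloor>)"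
  shows "omega_rect TYPE('f) a b c \<le> w"
proof -
  obtain \<kappa>a where \<kappa>a: "0 < \<kappa>a" "\<And>n x. n \<ge> 1 \<Longrightarrow> 0 \<le> x \<Longrightarrow> x \<le> \<kappa>a * real n \<Longrightarrow> x powr a \<le> real (dim_pow n a)"
    using dim_pow_ge_powr_scaled[OF abc(1)] by blast
  obtain \<kappa>b where \<kappa>b: "0 < \<kappa>b" "\<And>n x. n \<ge> 1 \<Longrightarrow> 0 \<le> x \<Longrightarrow> x \<le> \<kappa>b * real n \<Longrightarrow> x powr b \<le> real (dim_pow n b)"
    using dim_pow_ge_powr_scaled[OF abc(2)] by blast
  obtain \<kappa>c where \<kappa>c: "0 < \<kappa>c" "\<And>n x. n \<ge> 1 \<Longrightarrow> 0 \<le> x \<Longrightarrow> x \<le> \<kappa>c * real n \<Longrightarrow> x powr c \<le> real (dim_pow n c)"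
    using dim_pow_ge_powr_scaled[OF abc(3)] by blast
  define \<kappa> where "\<kappa> = min \<kappa>a (min \<kappa>b \<kappa>c)"
  have \<kappa>: "\<kappa> > 0" using \<kappa>a(1) \<kappa>b(1) \<kappa>c(1) by (simp add: \<kappa>_def)
  have bound: "omega_rect TYPE('f) a b c \<le> (ln C + w * ln (real n)) / ln (\<kappa> * real n)"
    if n: "\<kappa> * real n > 1" for n
  proof -
    have n1: "n \<ge> 1" using n by (cases n) auto
    have le: "0 \<le> \<kappa> * real n" "\<kappa> * real n \<le> \<kappa>a * real n"
      "\<kappa> * real n \<le> \<kappa>b * real n" "\<kappa> * real n \<le> \<kappa>c * real n"
      using \<kappa> by (auto intro!: mult_right_mono simp: \<kappa>_def)
    note dims = \<kappa>a(2)[OF n1 le(1,2)] \<kappa>b(2)[OF n1 le(1,3)] \<kappa>c(2)[OF n1 le(1,4)]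
    have "omega_rect TYPE('f) a b c \<le> log (\<kappa> * real n) (C * real n powr w)"
      by (rule omega_rect_le_log_ratfun_rank[OF n rank[OF n1] abc dims])
    also have "\<dots> = (ln C + w * ln (real n)) / ln (\<kappa> * real n)"
      unfolding log_def using C n1 by (simp add: ln_mult ln_powr)
    finally show ?thesis .
  qed
  have "(\<lambda>n. (ln C + w * ln (real n)) / ln (\<kappa> * real n)) \<longlonglongrightarrow> w"
    using \<kappa> by real_asymp
  moreover have "eventually (\<lambda>n. \<kappa> * real n > 1) sequentially"
    using \<kappa> by real_asymp
  ultimately show ?thesis
    by (rule tendsto_lowerbound[OF _ eventually_mono[OF _ bound] sequentially_bot])
qed

lemma omega_rect_le_omega_rect_min:
  assumes a: "0 \<le> a" "a \<le> 1" and b: "0 \<le> b" "b \<le> 1"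
  shows "omega_rect TYPE('f::field) a 1 b \<le> omega_rect TYPE('f) 1 1 (min a b)"
proof (rule le_omega_rect)
  fix w assume "w \<in> omega_exponents TYPE('f) 1 1 (min a b)"
  then obtain C where C: "C > 0" "\<And>n. n \<ge> 1 \<Longrightarrow> matmul_rank_le (UNIV :: 'f ratfun set)
      (dim_pow n 1) (dim_pow n 1) (dim_pow n (min a b)) (nat \<lfloor>C * real n powr w\<rfloor>)"
    by (rule omega_exponent_imp_ratfun_rank) blast
  have "matmul_rank_le (UNIV :: 'f ratfun set)
      (dim_pow n a) (dim_pow n 1) (dim_pow n b) (nat \<lfloor>C * real n powr w\<rfloor>)"
    if n: "n \<ge> 1" for n
  proof (cases "a \<le> b")
    case True
    show ?thesis
      by (rule matmul_rank_le_antimono[OF matmul_rank_le_transpose[OF C(2)[OF n]]])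
         (use True b in \<open>auto intro: dim_pow_le simp: min_def\<close>)
  next
    case False
    show ?thesis
      by (rule matmul_rank_le_antimono[OF C(2)[OF n]])
         (use False a in \<open>auto intro: dim_pow_le simp: min_def\<close>)
  qed
  then show "omega_rect TYPE('f) a 1 b \<le> w"
    by (rule omega_rect_le_if_ratfun_rank_bound[OF a(1) zero_le_one b(1) C(1)])
qed (use a in auto)

section \<open>Recovering a matrix from two-sided compressions\<close>

locale recoverable_compressions =
  fixes I :: "'i set" and n :: nat and p s :: "'i \<Rightarrow> nat"
    and L R :: "'i \<Rightarrow> nat \<Rightarrow> nat \<Rightarrow> 'k::field" and c :: "nat \<times> nat \<Rightarrow> 'i \<Rightarrow> nat \<times> nat \<Rightarrow> 'k"
  assumes finite_I: "finite I"
    and recover: "\<And>x y u v. x < n \<Longrightarrow> y < n \<Longrightarrow> u < n \<Longrightarrow> v < n \<Longrightarrow>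
      (\<Sum>i\<in>I. \<Sum>z\<in>{..<p i} \<times> {..<s i}. c (x, y) i z * (L i (fst z) u * R i v (snd z)))
      = of_bool (x = u \<and> y = v)"

lemma recoverable_compressions_hom:
  fixes \<phi> :: "'k::field \<Rightarrow> 'm::field"
  assumes "recoverable_compressions I n p s L R c"
    and \<phi>: "\<phi> 0 = 0" "\<phi> 1 = 1" "\<And>x y. \<phi> (x + y) = \<phi> x + \<phi> y" "\<And>x y. \<phi> (x * y) = \<phi> x * \<phi> y"
  shows "recoverable_compressions I n p s (\<lambda>i a u. \<phi> (L i a u)) (\<lambda>i v b. \<phi> (R i v b)) (\<lambda>x i z. \<phi> (c x i z))"
proof
  interpret recoverable_compressions I n p s L R c by fact
  show "finite I" by (rule finite_I)
  have \<phi>_sum: "\<phi> (sum t A) = (\<Sum>x\<in>A. \<phi> (t x))" for t :: "'z \<Rightarrow> 'k" and A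
    by (induction A rule: infinite_finite_induct) (simp_all add: \<phi>)
  fix x y u v assume "x < n" "y < n" "u < n" "v < n"
  from arg_cong[OF recover[OF this], of \<phi>]
  show "(\<Sum>i\<in>I. \<Sum>z\<in>{..<p i} \<times> {..<s i}. \<phi> (c (x, y) i z) * (\<phi> (L i (fst z) u) * \<phi> (R i v (snd z))))
      = of_bool (x = u \<and> y = v)"
    by (simp add: \<phi>_sum \<phi> of_bool_def split: if_splits)
qed

lemma block_index_eq_iff:
  fixes a b y z P :: nat
  assumes "y < P" "z < P"
  shows "a * P + y = b * P + z \<longleftrightarrow> a = b \<and> y = z"
proof
  assume eq: "a * P + y = b * P + z"
  show "a = b \<and> y = z"
    using arg_cong[OF eq, of "\<lambda>x. x div P"] arg_cong[OF eq, of "\<lambda>x. x mod P"] assms by simp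
qed simp

context recoverable_compressions
begin

lemma square_le_sum_compressed_dims: "n * n \<le> (\<Sum>i\<in>I. p i * s i)"
proof -
  let ?\<Lambda> = "SIGMA i:I. {..<p i} \<times> {..<s i}"
  have "card ({..<n} \<times> {..<n}) \<le> card ?\<Lambda>"
  proof (rule biorthogonal_card_le[where X = "\<lambda>x l. c x (fst l) (snd l)"
        and Y = "\<lambda>l x. L (fst l) (fst (snd l)) (fst x) * R (fst l) (snd x) (snd (snd l))"])
    fix x x' assume "x \<in> {..<n} \<times> {..<n}" "x' \<in> {..<n} \<times> {..<n}"
    then show "(\<Sum>l\<in>?\<Lambda>. c x (fst l) (snd l) *
        (L (fst l) (fst (snd l)) (fst x') * R (fst l) (snd x') (snd (snd l)))) = of_bool (x = x')"
      using recover[of "fst x" "snd x" "fst x'" "snd x'"] finite_I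
      by (simp add: sum.Sigma case_prod_beta prod_eq_iff mem_Times_iff)
  qed (use finite_I in auto)
  then show ?thesis using finite_I by simp
qed

definition compressed_tensor ::
    "nat \<Rightarrow> nat \<Rightarrow> 'i \<Rightarrow> nat \<times> 'j \<Rightarrow> 'j \<times> nat \<Rightarrow> nat \<times> nat \<Rightarrow> 'k" where
  "compressed_tensor P T i = (\<lambda>(x, j) (j', y) (x', y').
     \<Sum>u<p i. \<Sum>v<s i. \<Sum>w\<in>{..<p i} \<times> {..<s i}.
       L i u (x div P) * R i (y div T) v * c (x' div P, y' div T) i w *
       matmul_tensor (u * P + x mod P, j) (j', v * T + y mod T)
         (fst w * P + x' mod P, snd w * T + y' mod T))"

lemma tensor_rank_le_compressed_tensor:
  assumes "matmul_rank_le (UNIV :: 'k set) (p i * P) Q (s i * T) \<rho>"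
  shows "tensor_rank_le UNIV ({..<n * P} \<times> {..<Q}) ({..<Q} \<times> {..<n * T}) ({..<n * P} \<times> {..<n * T})
    (compressed_tensor P T i) \<rho>"
  unfolding compressed_tensor_def case_prod_beta
  by (rule tensor_rank_le_restrict[OF assms[unfolded matmul_rank_le_def]])
     (auto intro!: block_index_less mod_less_divisor gr0I)

lemma compressed_tensor_eq:
  assumes "P > 0" "T > 0"
  shows "compressed_tensor P T i (x, j) (j', y) (x', y') =
    (\<Sum>w\<in>{..<p i} \<times> {..<s i}.
       c (x' div P, y' div T) i w * (L i (fst w) (x div P) * R i (y div T) (snd w))) *
    of_bool (x mod P = x' mod P \<and> j = j' \<and> y mod T = y' mod T)"
proof -
  let ?rest = "of_bool (x mod P = x' mod P \<and> j = j' \<and> y mod T = y' mod T) :: 'k"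
  have "matmul_tensor (u * P + x mod P, j) (j', v * T + y mod T)
        (fst w * P + x' mod P, snd w * T + y' mod T)
      = of_bool (u = fst w) * (of_bool (v = snd w) * ?rest)" for u v w
    using assms by (auto simp: block_index_eq_iff)
  then have "compressed_tensor P T i (x, j) (j', y) (x', y')
    = (\<Sum>w\<in>{..<p i} \<times> {..<s i}. \<Sum>u<p i. of_bool (u = fst w) * (\<Sum>v<s i. of_bool (v = snd w) *
        (c (x' div P, y' div T) i w * (L i u (x div P) * R i (y div T) v) * ?rest)))"
    unfolding compressed_tensor_def prod.case
    by (simp only: sum_distrib_left mult_ac sum.swap[of _ "{..<p i} \<times> {..<s i}"])
  also have "\<dots> = (\<Sum>w\<in>{..<p i} \<times> {..<s i}.
      c (x' div P, y' div T) i w * (L i (fst w) (x div P) * R i (y div T) (snd w))) * ?rest"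
    by (auto simp: sum_distrib_right sum_of_bool_mult(1) intro!: sum.cong)
  finally show ?thesis .
qed

lemma sum_compressed_tensor:
  assumes "x < n * P" "x' < n * P" "y < n * T" "y' < n * T"
  shows "(\<Sum>i\<in>I. compressed_tensor P T i (x, j) (j', y) (x', y')) = matmul_tensor (x, j) (j', y) (x', y')"
proof -
  have "P > 0" "T > 0"
    using assms by (auto intro: gr0I)
  then have "(\<Sum>i\<in>I. compressed_tensor P T i (x, j) (j', y) (x', y'))
    = of_bool (x' div P = x div P \<and> y' div T = y div T) *
      of_bool (x mod P = x' mod P \<and> j = j' \<and> y mod T = y' mod T)"
    using assms by (simp add: compressed_tensor_eq recover less_mult_imp_div_less flip: sum_distrib_right)
  also have "\<dots> = matmul_tensor (x, j) (j', y) (x', y')"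
    by (auto simp: div_mod_eq_iff[of x x' P] div_mod_eq_iff[of y y' T])
  finally show ?thesis .
qed

lemma matmul_rank_le_reduce:
  assumes "\<And>i. i \<in> I \<Longrightarrow> matmul_rank_le (UNIV :: 'k set) (p i * P) Q (s i * T) (\<rho> i)"
  shows "matmul_rank_le (UNIV :: 'k set) (n * P) Q (n * T) (\<Sum>i\<in>I. \<rho> i)"
  unfolding matmul_rank_le_def
  by (rule tensor_rank_le_reindex[OF tensor_rank_le_sum[OF finite_I
          tensor_rank_le_compressed_tensor[OF assms]], of _ id _ id _ id])
     (auto simp: sum_compressed_tensor simp del: matmul_tensor_apply)

lemma matmul_rank_le_reduce_floor:
  fixes B :: "'i \<Rightarrow> real"
  assumes B: "\<And>i. i \<in> I \<Longrightarrow> B i \<ge> 0"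
    and rank: "\<And>i. i \<in> I \<Longrightarrow> matmul_rank_le (UNIV :: 'k set) (p i * P) Q (s i * T) (nat \<lfloor>B i\<rfloor>)"
  shows "matmul_rank_le (UNIV :: 'k set) (n * P) Q (n * T) (nat \<lfloor>\<Sum>i\<in>I. B i\<rfloor>)"
proof (rule matmul_rank_le_mono[OF matmul_rank_le_reduce[OF rank]])
  have "real (\<Sum>i\<in>I. nat \<lfloor>B i\<rfloor>) \<le> (\<Sum>i\<in>I. B i)"
    unfolding of_nat_sum using B by (intro sum_mono) auto
  then show "(\<Sum>i\<in>I. nat \<lfloor>B i\<rfloor>) \<le> nat \<lfloor>\<Sum>i\<in>I. B i\<rfloor>"
    by (rule le_nat_floor)
qed

lemma matmul_rank_le_power_reduce:
  fixes C :: real and y :: "'i \<Rightarrow> real"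
  assumes C: "C \<ge> 0" and y: "\<And>i. i \<in> I \<Longrightarrow> y i \<ge> 0"
    and rank: "\<And>i m. i \<in> I \<Longrightarrow>
      matmul_rank_le (UNIV :: 'k set) (p i ^ m) (n ^ m) (s i ^ m) (nat \<lfloor>C * y i ^ m\<rfloor>)"
  shows "matmul_rank_le (UNIV :: 'k set)
    (n ^ m * (\<Prod>i\<in>I. p i ^ d i)) (n ^ (m + (\<Sum>i\<in>I. d i))) (n ^ m * (\<Prod>i\<in>I. s i ^ d i))
    (nat \<lfloor>C ^ card I * (\<Sum>i\<in>I. y i) ^ m * (\<Prod>i\<in>I. y i ^ d i)\<rfloor>)"
proof (induction m arbitrary: d)
  case 0
  have "matmul_rank_le (UNIV :: 'k set) (\<Prod>i\<in>I. p i ^ d i) (\<Prod>i\<in>I. n ^ d i) (\<Prod>i\<in>I. s i ^ d i)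
      (nat \<lfloor>\<Prod>i\<in>I. C * y i ^ d i\<rfloor>)"
    using C y by (intro matmul_rank_le_prod_floor finite_I rank) auto
  then show ?case
    by (simp add: prod.distrib power_sum)
next
  case (Suc m)
  let ?B = "C ^ card I * (\<Sum>i\<in>I. y i) ^ m * (\<Prod>i\<in>I. y i ^ d i)"
  let ?P = "n ^ m * (\<Prod>i\<in>I. p i ^ d i)" and ?T = "n ^ m * (\<Prod>i\<in>I. s i ^ d i)"
  let ?Q = "n ^ (Suc m + (\<Sum>i\<in>I. d i))"
  have "matmul_rank_le (UNIV :: 'k set) (p i * ?P) ?Q (s i * ?T) (nat \<lfloor>y i * ?B\<rfloor>)" if "i \<in> I" for i
  proof -
    have "(\<Sum>j\<in>I. (d(i := Suc (d i))) j) = Suc (\<Sum>j\<in>I. d j)"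
      using that finite_I by (simp add: sum.remove fun_upd_def)
    then show ?thesis
      using Suc.IH[of "d(i := Suc (d i))"]
      unfolding prod_power_fun_upd_Suc[OF finite_I that] by (simp add: mult_ac)
  qed
  moreover have "?B \<ge> 0"
    using C y by (intro mult_nonneg_nonneg zero_le_power sum_nonneg prod_nonneg) auto
  ultimately have "matmul_rank_le (UNIV :: 'k set) (n * ?P) ?Q (n * ?T) (nat \<lfloor>\<Sum>i\<in>I. y i * ?B\<rfloor>)"
    using y by (intro matmul_rank_le_reduce_floor) auto
  then show ?case
    by (simp add: mult_ac flip: sum_distrib_right)
qed

end

lemma matmul_ratfun_rank_le_sum_powr_power:
  fixes L R :: "'i \<Rightarrow> nat \<Rightarrow> nat \<Rightarrow> 'f::field"
  assumes recoverable: "recoverable_compressions I n p s L R c" and n: "n > 0"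
    and p: "\<And>i. i \<in> I \<Longrightarrow> real (p i) = real n powr \<alpha> i" and s: "\<And>i. i \<in> I \<Longrightarrow> real (s i) = real n powr \<beta> i"
    and w: "\<And>i. i \<in> I \<Longrightarrow> w i \<in> omega_exponents TYPE('f) (\<alpha> i) 1 (\<beta> i)"
  obtains C where "C > 0" "\<And>m. matmul_rank_le (UNIV :: 'f ratfun set) (n ^ m) (n ^ m) (n ^ m)
    (nat \<lfloor>C * (\<Sum>i\<in>I. real n powr w i) ^ m\<rfloor>)"
proof -
  interpret recoverable_compressions I n p s "\<lambda>i a u. rf_const (L i a u) :: 'f ratfun"
    "\<lambda>i v b. rf_const (R i v b)" "\<lambda>x i z. rf_const (c x i z)"
    by (rule recoverable_compressions_hom[OF recoverable]) (simp_all add: rf_const_add rf_const_mult)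
  let ?y = "\<lambda>i. real n powr w i"
  have "\<forall>i\<in>I. \<exists>C>0. \<forall>m. matmul_rank_le (UNIV :: 'f ratfun set)
      (p i ^ m) (n ^ m) (s i ^ m) (nat \<lfloor>C * ?y i ^ m\<rfloor>)"
    using omega_exponent_imp_ratfun_rank_power[OF w n p s] by metis
  then obtain C where C: "\<And>i. i \<in> I \<Longrightarrow> C i > 0"
    "\<And>i m. i \<in> I \<Longrightarrow> matmul_rank_le (UNIV :: 'f ratfun set)
      (p i ^ m) (n ^ m) (s i ^ m) (nat \<lfloor>C i * ?y i ^ m\<rfloor>)"
    by metis
  define C' where "C' = 1 + sum C I"
  have "sum C I \<ge> 0"
    using C(1) by (intro sum_nonneg) (auto intro: less_imp_le)
  then have C': "C' > 0"
    by (simp add: C'_def)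
  have "C i \<le> sum C I" if "i \<in> I" for i
    using C(1) finite_I that by (intro member_le_sum) (auto intro: less_imp_le)
  then have "C i \<le> C'" if "i \<in> I" for i
    using that by (simp add: C'_def add_increasing)
  then have rank: "matmul_rank_le (UNIV :: 'f ratfun set)
      (p i ^ m) (n ^ m) (s i ^ m) (nat \<lfloor>C' * ?y i ^ m\<rfloor>)" if "i \<in> I" for i m
    using that by (intro matmul_rank_le_mono[OF C(2)] nat_mono floor_mono mult_right_mono) auto
  have "matmul_rank_le (UNIV :: 'f ratfun set) (n ^ m) (n ^ m) (n ^ m)
      (nat \<lfloor>C' ^ card I * (\<Sum>i\<in>I. ?y i) ^ m\<rfloor>)" for m
    using matmul_rank_le_power_reduce[of C' ?y m "\<lambda>_. 0", OF _ _ rank] C' by simp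
  then show thesis
    by (rule that[rotated]) (use C' in simp)
qed

lemma powr_omega_le_sum_powr_exponents:
  fixes L R :: "'i \<Rightarrow> nat \<Rightarrow> nat \<Rightarrow> 'f::field"
  assumes recoverable: "recoverable_compressions I n p s L R c" and n: "n > 0"
    and p: "\<And>i. i \<in> I \<Longrightarrow> real (p i) = real n powr \<alpha> i" and s: "\<And>i. i \<in> I \<Longrightarrow> real (s i) = real n powr \<beta> i"
    and w: "\<And>i. i \<in> I \<Longrightarrow> w i \<in> omega_exponents TYPE('f) (\<alpha> i) 1 (\<beta> i)"
  shows "real n powr omega TYPE('f) \<le> (\<Sum>i\<in>I. real n powr w i)" (is "_ \<le> ?S")
proof -
  interpret recoverable_compressions I n p s L R c by fact
  have I: "I \<noteq> {}"
    using square_le_sum_compressed_dims n by auto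
  show ?thesis
  proof (cases "n = 1")
    case True
    then show ?thesis
      using I finite_I by (simp add: Suc_le_eq card_gt_0_iff)
  next
    case False
    then have n1: "real n > 1" using n by simp
    have S: "?S > 0"
      using finite_I n I by (intro sum_pos) auto
    obtain C where "C > 0" "\<And>m. matmul_rank_le (UNIV :: 'f ratfun set)
        (n ^ m) (n ^ m) (n ^ m) (nat \<lfloor>C * ?S ^ m\<rfloor>)"
      using matmul_ratfun_rank_le_sum_powr_power[OF recoverable n p s w] by blast
    then have "omega TYPE('f) \<le> log (real n) ?S"
      unfolding omega_def using n1 S
      by (intro omega_rect_le_log_asymptotic_ratfun_rank[of "real n" ?S C n n n]) auto
    then show ?thesis
      using n1 S by (simp add: le_log_iff)
  qed
qed

lemma powr_omega_le_sum_powr_omega_rect: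
  fixes L R :: "'i \<Rightarrow> nat \<Rightarrow> nat \<Rightarrow> 'f::field"
  assumes recoverable: "recoverable_compressions I n p s L R c" and n: "n > 0"
    and p: "\<And>i. i \<in> I \<Longrightarrow> real (p i) = real n powr \<alpha> i" and s: "\<And>i. i \<in> I \<Longrightarrow> real (s i) = real n powr \<beta> i"
    and le_1: "\<And>i. i \<in> I \<Longrightarrow> \<alpha> i \<le> 1" "\<And>i. i \<in> I \<Longrightarrow> \<beta> i \<le> 1"
  shows "real n powr omega TYPE('f) \<le> (\<Sum>i\<in>I. real n powr omega_rect TYPE('f) (\<alpha> i) 1 (\<beta> i))"
    (is "_ \<le> ?S")
proof -
  have bound: "real n powr omega TYPE('f) \<le> ?S * real n powr (1 / real (Suc m))" for m
  proof -
    have "\<forall>i\<in>I. \<exists>w\<in>omega_exponents TYPE('f) (\<alpha> i) 1 (\<beta> i).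
        w < omega_rect TYPE('f) (\<alpha> i) 1 (\<beta> i) + 1 / real (Suc m)"
      using le_1 by (intro ballI omega_rect_approx) auto
    then obtain w where w: "\<And>i. i \<in> I \<Longrightarrow> w i \<in> omega_exponents TYPE('f) (\<alpha> i) 1 (\<beta> i)"
      "\<And>i. i \<in> I \<Longrightarrow> w i < omega_rect TYPE('f) (\<alpha> i) 1 (\<beta> i) + 1 / real (Suc m)"
      by metis
    have "real n powr omega TYPE('f) \<le> (\<Sum>i\<in>I. real n powr w i)"
      by (rule powr_omega_le_sum_powr_exponents[OF recoverable n p s w(1)])
    also have "\<dots> \<le> (\<Sum>i\<in>I. real n powr (omega_rect TYPE('f) (\<alpha> i) 1 (\<beta> i) + 1 / real (Suc m)))"
      using n w(2) by (intro sum_mono powr_mono) (auto intro: less_imp_le)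
    also have "\<dots> = ?S * real n powr (1 / real (Suc m))"
      by (simp only: powr_add sum_distrib_right)
    finally show ?thesis .
  qed
  have "(\<lambda>m. real n powr (1 / real (Suc m))) \<longlonglongrightarrow> real n powr 0"
    using n by (intro tendsto_powr tendsto_const LIMSEQ_Suc[OF lim_1_over_n]) auto
  then have "(\<lambda>m. ?S * real n powr (1 / real (Suc m))) \<longlonglongrightarrow> ?S * real n powr 0"
    by (rule tendsto_mult_left)
  then show ?thesis
    using n LIMSEQ_le_const[of _ ?S] bound by auto
qed

lemma mult_mult_mat_index:
  fixes L M R :: "'f::comm_semiring_1 mat"
  assumes "L \<in> carrier_mat p n" "M \<in> carrier_mat n n" "R \<in> carrier_mat n s" "a < p" "b < s"
  shows "(L * M * R) $$ (a, b) = (\<Sum>(u, v)\<in>{..<n} \<times> {..<n}. L $$ (a, u) * R $$ (v, b) * M $$ (u, v))"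
proof -
  have "(L * M * R) $$ (a, b) = (\<Sum>v<n. (L * M) $$ (a, v) * R $$ (v, b))"
    using assms by (intro mult_mat_index) auto
  also have "\<dots> = (\<Sum>v<n. (\<Sum>u<n. L $$ (a, u) * M $$ (u, v)) * R $$ (v, b))"
    using assms by (intro sum.cong refl arg_cong2[where f = "(*)"] mult_mat_index) auto
  also have "\<dots> = (\<Sum>u<n. \<Sum>v<n. L $$ (a, u) * R $$ (v, b) * M $$ (u, v))"
    unfolding sum_distrib_right by (subst sum.swap) (simp add: mult_ac)
  finally show ?thesis
    by (simp add: sum.cartesian_product)
qed

lemma mult_mult_mat_eq_0:
  fixes L R :: "'f::comm_semiring_1 mat"
  assumes L: "L \<in> carrier_mat p n" and R: "R \<in> carrier_mat n s"
    and "\<And>a b. a < p \<Longrightarrow> b < s \<Longrightarrow> (\<Sum>(u, v)\<in>{..<n} \<times> {..<n}. L $$ (a, u) * R $$ (v, b) * m (u, v)) = 0"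
  shows "L * mat n n m * R = 0\<^sub>m p s"
proof (rule eq_matI)
  fix a b assume ab: "a < dim_row (0\<^sub>m p s :: 'f mat)" "b < dim_col (0\<^sub>m p s :: 'f mat)"
  then have "(L * mat n n m * R) $$ (a, b)
      = (\<Sum>(u, v)\<in>{..<n} \<times> {..<n}. L $$ (a, u) * R $$ (v, b) * mat n n m $$ (u, v))"
    by (intro mult_mult_mat_index[OF L _ R]) auto
  also have "\<dots> = (\<Sum>(u, v)\<in>{..<n} \<times> {..<n}. L $$ (a, u) * R $$ (v, b) * m (u, v))"
    by (rule sum.cong) auto
  finally show "(L * mat n n m * R) $$ (a, b) = 0\<^sub>m p s $$ (a, b)"
    using ab assms(3) by simp
qed (use L R in auto)

lemma separating_imp_recoverable_compressions:
  fixes L R :: "'i \<Rightarrow> 'f::field mat"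
  assumes fin: "finite I"
    and L: "\<And>i. i \<in> I \<Longrightarrow> L i \<in> carrier_mat (p i) n" and R: "\<And>i. i \<in> I \<Longrightarrow> R i \<in> carrier_mat n (s i)"
    and sep: "\<And>M. M \<in> carrier_mat n n \<Longrightarrow> (\<And>i. i \<in> I \<Longrightarrow> L i * M * R i = 0\<^sub>m (p i) (s i)) \<Longrightarrow> M = 0\<^sub>m n n"
  obtains c where
    "recoverable_compressions I n p s (\<lambda>i a u. L i $$ (a, u)) (\<lambda>i v b. R i $$ (v, b)) c"
proof -
  define \<Lambda> where "\<Lambda> = (SIGMA i:I. {..<p i} \<times> {..<s i})"
  define W where "W = (\<lambda>(i, a, b) (u, v). L i $$ (a, u) * R i $$ (v, b))"
  have kernel: "\<forall>m. (\<forall>l\<in>\<Lambda>. (\<Sum>x\<in>{..<n} \<times> {..<n}. W l x * m x) = 0) \<longrightarrow> (\<forall>x\<in>{..<n} \<times> {..<n}. m x = 0)"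
  proof (intro allI impI ballI)
    fix m x
    assume m: "\<forall>l\<in>\<Lambda>. (\<Sum>x\<in>{..<n} \<times> {..<n}. W l x * m x) = 0" and x: "x \<in> {..<n} \<times> {..<n}"
    have "L i * mat n n m * R i = 0\<^sub>m (p i) (s i)" if i: "i \<in> I" for i
    proof (rule mult_mult_mat_eq_0[OF L[OF i] R[OF i]])
      fix a b assume "a < p i" "b < s i"
      with i m have "(\<Sum>x\<in>{..<n} \<times> {..<n}. W (i, a, b) x * m x) = 0"
        by (simp add: \<Lambda>_def)
      then show "(\<Sum>(u, v)\<in>{..<n} \<times> {..<n}. L i $$ (a, u) * R i $$ (v, b) * m (u, v)) = 0"
        by (simp add: W_def case_prod_beta)
    qed
    from sep[OF mat_carrier this] show "m x = 0"
      using x by (auto simp: mat_eq_iff)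
  qed
  have finite: "finite \<Lambda>" "finite ({..<n} \<times> {..<n})"
    using fin by (simp_all add: \<Lambda>_def)
  obtain c where c: "\<forall>x\<in>{..<n} \<times> {..<n}. \<forall>x'\<in>{..<n} \<times> {..<n}.
      (\<Sum>l\<in>\<Lambda>. c x l * W l x') = of_bool (x = x')"
    by (rule injective_left_inverse_coeffs[OF finite kernel])
  have "recoverable_compressions I n p s
      (\<lambda>i a u. L i $$ (a, u)) (\<lambda>i v b. R i $$ (v, b)) (\<lambda>x i z. c x (i, z))"
  proof
    fix x y u v assume "x < n" "y < n" "u < n" "v < n"
    then have "(\<Sum>l\<in>\<Lambda>. c (x, y) l * W l (u, v)) = of_bool ((x, y) = (u, v))"
      by (intro c[rule_format]) auto
    then show "(\<Sum>i\<in>I. \<Sum>z\<in>{..<p i} \<times> {..<s i}. c (x, y) (i, z) * (L i $$ (fst z, u) * R i $$ (v, snd z)))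
        = of_bool (x = u \<and> y = v)"
      using fin by (simp add: \<Lambda>_def W_def sum.Sigma case_prod_beta)
  qed (rule fin)
  then show thesis by (rule that)
qed

theorem theorem3p7:
  fixes n k :: nat
    and L R :: "nat \<Rightarrow> 'f::field mat"
    and \<alpha> \<beta> :: "nat \<Rightarrow> real"
  assumes n_pos: "0 < n"
    and alpha: "\<And>i. i \<in> {1..k} \<Longrightarrow> 0 \<le> \<alpha> i \<and> \<alpha> i \<le> 1"
    and beta: "\<And>i. i \<in> {1..k} \<Longrightarrow> 0 \<le> \<beta> i \<and> \<beta> i \<le> 1"
    and L_dim: "\<And>i. i \<in> {1..k} \<Longrightarrow>
       real (dim_row (L i)) = real n powr \<alpha> i \<and> dim_col (L i) = n"
    and R_dim: "\<And>i. i \<in> {1..k} \<Longrightarrow>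
       dim_row (R i) = n \<and> real (dim_col (R i)) = real n powr \<beta> i"
    and L_rank: "\<And>i. i \<in> {1..k} \<Longrightarrow>
       real (vec_space.rank (dim_row (L i)) (L i)) = real n powr \<alpha> i"
    and R_rank: "\<And>i. i \<in> {1..k} \<Longrightarrow>
       real (vec_space.rank (dim_row (R i)) (R i)) = real n powr \<beta> i"
    and zero_iff: "\<And>A B. A \<in> carrier_mat n n \<Longrightarrow> B \<in> carrier_mat n n \<Longrightarrow>
       A * B = 0\<^sub>m n n \<longleftrightarrow>
       (\<forall>i\<in>{1..k}. L i * A * B * R i = 0\<^sub>m (dim_row (L i)) (dim_col (R i)))"
  shows "(\<Sum>i=1..k. real n powr (\<alpha> i + \<beta> i)) \<ge> (real n)\<^sup>2
       \<and> (\<Sum>i=1..k. real n powr omega_rect TYPE('f) 1 1 (min (\<alpha> i) (\<beta> i)))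
            \<ge> (\<Sum>i=1..k. real n powr omega_rect TYPE('f) (\<alpha> i) 1 (\<beta> i))
       \<and> (\<Sum>i=1..k. real n powr omega_rect TYPE('f) (\<alpha> i) 1 (\<beta> i))
            \<ge> real n powr omega TYPE('f)"
proof (intro conjI)
  let ?p = "\<lambda>i. dim_row (L i)" and ?s = "\<lambda>i. dim_col (R i)"
  have carrier: "L i \<in> carrier_mat (?p i) n" "R i \<in> carrier_mat n (?s i)" if "i \<in> {1..k}" for i
    using L_dim[OF that] R_dim[OF that] by auto
  have separating: "M = 0\<^sub>m n n" if M: "M \<in> carrier_mat n n"
    and zero: "\<And>i. i \<in> {1..k} \<Longrightarrow> L i * M * R i = 0\<^sub>m (?p i) (?s i)" for M
    using zero_iff[OF M one_carrier_mat] M zero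
      right_mult_one_mat[OF mult_carrier_mat[OF carrier(1) M]] by simp
  obtain c where recoverable:
    "recoverable_compressions {1..k} n ?p ?s (\<lambda>i a u. L i $$ (a, u)) (\<lambda>i v b. R i $$ (v, b)) c"
    by (rule separating_imp_recoverable_compressions[OF finite_atLeastAtMost carrier separating])
  have "real (n * n) \<le> real (\<Sum>i=1..k. ?p i * ?s i)"
    by (rule of_nat_mono[OF recoverable_compressions.square_le_sum_compressed_dims[OF recoverable]])
  then show "(real n)\<^sup>2 \<le> (\<Sum>i=1..k. real n powr (\<alpha> i + \<beta> i))"
    using L_dim R_dim by (simp add: power2_eq_square powr_add)
  show "(\<Sum>i=1..k. real n powr omega_rect TYPE('f) (\<alpha> i) 1 (\<beta> i))
      \<le> (\<Sum>i=1..k. real n powr omega_rect TYPE('f) 1 1 (min (\<alpha> i) (\<beta> i)))"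
    using alpha beta n_pos by (intro sum_mono powr_mono omega_rect_le_omega_rect_min) auto
  show "real n powr omega TYPE('f) \<le> (\<Sum>i=1..k. real n powr omega_rect TYPE('f) (\<alpha> i) 1 (\<beta> i))"
    by (rule powr_omega_le_sum_powr_omega_rect[OF recoverable n_pos]) (use L_dim R_dim alpha beta in auto)
qed

end
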